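(* Let $q$ be a prime power, let $n \geq 2$ and $1 \leq d \leq n-1$ be integers, and let $\ell \geq 1$ be an integer. Let $S \subset \mathbb{F}_q^n$ be an $(n,d)$-BRK-type set of degree $\ell$ (as defined in the context). Then \[|S| \geq \frac{(q-1)^n}{(\ell + 1 - 2\ell/q)^n}.\]
   Context: $\mathbb{F}_q$ denotes the finite field with $q$ elements. For a homogeneous polynomial $h \in \mathbb{F}_q[x_1,\dots,x_d]$, let $\mathcal{P}_h \subset \mathbb{F}_q[x_1,\dots,x_d]$ be the set of all polynomials whose homogeneous part of highest degree equals $h$. For a positive integer $\ell$, a set $S \subset \mathbb{F}_q^n$ is an $(n,d)$-BRK-type set of degree $\ell$ if there exist homogeneous polynomials $h_1,\dots,h_{n-d} \in \mathbb{F}_q[x_1,\dots,x_d]$ of degree $\ell$ such that for every $\rho = (\rho_1,\dots,\rho_{n-d}) \in \mathbb{F}_q^{n-d}$ there exist $a_\rho \in \mathbb{F}_q^n$ and polynomials $g_{\rho,1},\dots,g_{\rho,n-d} \in \mathbb{F}_q[x_1,\dots,x_d]$ with $g_{\rho,i} \in \mathcal{P}_{h_i}$ for each $i$, such that \[\{a_\rho + (t, \rho_1 g_{\rho,1}(t), \dots, \rho_{n-d} g_{\rho,n-d}(t)) : t \in \mathbb{F}_q^d\} \subset S.\] *)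

theory Defs
  imports Complex_Main "HOL-Library.FuncSet" "HOL-Library.Poly_Mapping" "HOL-Library.Cardinality"
begin

text \<open>The space \<open>F^n\<close> over a field type, with coordinates numbered \<open>0, \<dots>, n - 1\<close>.
  Vectors are extensional functions, so that \<open>card\<close> on sets of vectors is the intended one.\<close>

definition vecs :: "nat \<Rightarrow> (nat \<Rightarrow> 'a) set"
  where "vecs n = {..<n} \<rightarrow>\<^sub>E UNIV"

text \<open>Formal polynomials in the variables \<open>x\<^sub>0, x\<^sub>1, \<dots>\<close>: finitely supported maps from
  exponent vectors to coefficients. Over a finite field these must not be confused with
  the functions they induce.\<close>

type_synonym 'a mpoly = "(nat \<Rightarrow>\<^sub>0 nat) \<Rightarrow>\<^sub>0 'a"

definition mpolys :: "nat \<Rightarrow> ('a::zero) mpoly set"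
  where "mpolys d = {p. \<forall>m \<in> Poly_Mapping.keys p. Poly_Mapping.keys m \<subseteq> {..<d}}"

definition mono_degree :: "(nat \<Rightarrow>\<^sub>0 nat) \<Rightarrow> nat"
  where "mono_degree m = (\<Sum>i \<in> Poly_Mapping.keys m. Poly_Mapping.lookup m i)"

definition mpoly_eval :: "('a::comm_semiring_1) mpoly \<Rightarrow> (nat \<Rightarrow> 'a) \<Rightarrow> 'a"
  where "mpoly_eval p t =
    (\<Sum>m \<in> Poly_Mapping.keys p. Poly_Mapping.lookup p m *
      (\<Prod>i \<in> Poly_Mapping.keys m. t i ^ Poly_Mapping.lookup m i))"

text \<open>The zero polynomial gets total degree \<open>0\<close>.\<close>

definition total_degree :: "('a::zero) mpoly \<Rightarrow> nat"
  where "total_degree p = Max (insert 0 (mono_degree ` Poly_Mapping.keys p))"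

definition homogeneous_part :: "nat \<Rightarrow> ('a::comm_monoid_add) mpoly \<Rightarrow> 'a mpoly"
  where "homogeneous_part k p =
    (\<Sum>m \<in> {m \<in> Poly_Mapping.keys p. mono_degree m = k}.
      Poly_Mapping.single m (Poly_Mapping.lookup p m))"

text \<open>A homogeneous polynomial of degree \<open>k\<close> has degree exactly \<open>k\<close>; in particular it is
  not the zero polynomial.\<close>

definition homogeneous :: "nat \<Rightarrow> ('a::zero) mpoly \<Rightarrow> bool"
  where "homogeneous k p \<longleftrightarrow> p \<noteq> 0 \<and> (\<forall>m \<in> Poly_Mapping.keys p. mono_degree m = k)"

text \<open>The set \<open>P\<^sub>h\<close> of all polynomials in \<open>d\<close> variables whose homogeneous part of highest
  degree is \<open>h\<close>.\<close>

definition with_leading_form :: "nat \<Rightarrow> ('a::comm_monoid_add) mpoly \<Rightarrow> 'a mpoly set"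
  where "with_leading_form d h = {p \<in> mpolys d. homogeneous_part (total_degree p) p = h}"

text \<open>The point \<open>a + (t, \<rho>\<^sub>0 g\<^sub>0(t), \<dots>, \<rho>\<^sub>n\<^sub>-\<^sub>d\<^sub>-\<^sub>1 g\<^sub>n\<^sub>-\<^sub>d\<^sub>-\<^sub>1(t))\<close> of \<open>F^n\<close>.\<close>

definition brk_point ::
    "nat \<Rightarrow> nat \<Rightarrow> (nat \<Rightarrow> 'a) \<Rightarrow> (nat \<Rightarrow> 'a) \<Rightarrow> (nat \<Rightarrow> 'a mpoly) \<Rightarrow> (nat \<Rightarrow> 'a)
      \<Rightarrow> nat \<Rightarrow> 'a::comm_semiring_1"
  where "brk_point n d a \<rho> g t =
    (\<lambda>i \<in> {..<n}. a i + (if i < d then t i else \<rho> (i - d) * mpoly_eval (g (i - d)) t))"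

definition BRK_type_set :: "nat \<Rightarrow> nat \<Rightarrow> nat \<Rightarrow> (nat \<Rightarrow> 'a::field) set \<Rightarrow> bool"
  where "BRK_type_set n d l S \<longleftrightarrow>
    S \<subseteq> vecs n \<and>
    (\<exists>h :: nat \<Rightarrow> 'a mpoly.
      (\<forall>i < n - d. h i \<in> mpolys d \<and> homogeneous l (h i)) \<and>
      (\<forall>\<rho> \<in> vecs (n - d). \<exists>a \<in> vecs n. \<exists>g :: nat \<Rightarrow> 'a mpoly.
        (\<forall>i < n - d. g i \<in> with_leading_form d (h i)) \<and>
        {brk_point n d a \<rho> g t | t. t \<in> vecs d} \<subseteq> S))"

end

theory Submission imports Defs begin

text \<open>
  The proof is the method of multiplicities with weighted degrees. For \<open>l > q\<close> the bound is at most
  \<open>1\<close>. Otherwise, fix \<open>N \<ge> 1\<close> and put \<open>w = q N\<close> and \<open>r = N (l q + q - l)\<close>. If \<open>|S|\<close> times the number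
  of exponents of degree below \<open>r\<close> is smaller than the number of exponents of degree below \<open>q w\<close>,
  then some \<open>P \<noteq> 0\<close> of degree below \<open>q w\<close> vanishes to order \<open>r\<close> on \<open>S\<close>. Give the first \<open>d\<close>
  variables \<open>x\<close> weight \<open>1\<close> and the remaining variables \<open>y\<close> weight \<open>l\<close>; the weighted degree \<open>D\<close> of \<open>P\<close>
  is below \<open>l q w\<close>. For each \<open>\<rho>\<close>, the part of degree \<open>b < w\<close> in \<open>y\<close> of \<open>P (a + (x, y + \<rho> g(x)))\<close> has
  degree at most \<open>D - l b < q (r - b)\<close> in \<open>x\<close> and vanishes to order \<open>r - b\<close> on \<open>F^d\<close>, so it is zero.
  Passing to the terms of top weight, the top form \<open>T\<close> of \<open>P\<close> has order at least \<open>w\<close> in \<open>y\<close> at every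
  point \<open>y = \<rho> h(x)\<close> of a grid over \<open>F[x]\<close> with sides of size \<open>q\<close>, while its degree in \<open>y\<close> is below
  \<open>q w\<close>; hence \<open>T = 0\<close>, a contradiction. Counting exponents and letting \<open>N\<close> tend to infinity gives
  \<open>|S| \<ge> (q^2 / (l q + q - l))^n\<close>, which is stronger than the claim.
\<close>

subsection \<open>Substitution and weighted degrees of polynomials\<close>

definition mvar :: "nat \<Rightarrow> 'a::comm_ring_1 mpoly"
  where "mvar i = Poly_Mapping.single (Poly_Mapping.single i 1) 1"

definition mconst :: "'a::comm_ring_1 \<Rightarrow> 'a mpoly"
  where "mconst c = Poly_Mapping.single 0 c"

definition msubst_mono :: "(nat \<Rightarrow> 'a::comm_ring_1 mpoly) \<Rightarrow> (nat \<Rightarrow>\<^sub>0 nat) \<Rightarrow> 'a mpoly"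
  where "msubst_mono \<sigma> m = (\<Prod>i\<in>Poly_Mapping.keys m. \<sigma> i ^ Poly_Mapping.lookup m i)"

definition msubst :: "(nat \<Rightarrow> 'a::comm_ring_1 mpoly) \<Rightarrow> 'a mpoly \<Rightarrow> 'a mpoly"
  where "msubst \<sigma> p = (\<Sum>m\<in>Poly_Mapping.keys p. mconst (Poly_Mapping.lookup p m) * msubst_mono \<sigma> m)"

text \<open>One notion for every degree in use: \<open>u = (\<lambda>_. 1)\<close> gives the total
  degree, \<open>mem_weight Y\<close> the degree in the variables of \<open>Y\<close>, and weights 1
  and \<open>l\<close> the weighted degree.\<close>

definition wdeg :: "(nat \<Rightarrow> nat) \<Rightarrow> (nat \<Rightarrow>\<^sub>0 nat) \<Rightarrow> nat"
  where "wdeg u m = (\<Sum>i\<in>Poly_Mapping.keys m. u i * Poly_Mapping.lookup m i)"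

lemma mconst_simps [simp]:
  "mconst 0 = 0" "mconst 1 = 1"
  by (simp_all add: mconst_def)

lemma mconst_add: "mconst (a + b) = mconst a + mconst b"
  and mconst_mult: "mconst (a * b) = mconst a * mconst b"
  by (simp_all add: mconst_def single_add mult_single)

lemma mconst_power: "mconst (a ^ k) = mconst a ^ k"
  by (induction k) (simp_all add: mconst_mult)

lemma mconst_sum: "mconst (\<Sum>i\<in>A. f i) = (\<Sum>i\<in>A. mconst (f i))"
  by (induction A rule: infinite_finite_induct) (simp_all add: mconst_add)

lemma mconst_prod: "mconst (\<Prod>i\<in>A. f i) = (\<Prod>i\<in>A. mconst (f i))"
  by (induction A rule: infinite_finite_induct) (simp_all add: mconst_mult)

lemma poly_mapping_sum_singles:
  fixes p :: "'a \<Rightarrow>\<^sub>0 'b::comm_monoid_add"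
  shows "p = (\<Sum>m\<in>Poly_Mapping.keys p. Poly_Mapping.single m (Poly_Mapping.lookup p m))"
proof (rule poly_mapping_eqI)
  fix k
  have "Poly_Mapping.lookup (\<Sum>m\<in>Poly_Mapping.keys p. Poly_Mapping.single m (Poly_Mapping.lookup p m)) k
      = (\<Sum>m\<in>Poly_Mapping.keys p. if m = k then Poly_Mapping.lookup p m else 0)"
    by (simp add: lookup_sum lookup_single when_def)
  also have "\<dots> = Poly_Mapping.lookup p k"
    by (simp add: in_keys_iff)
  finally show "Poly_Mapping.lookup p k =
      Poly_Mapping.lookup (\<Sum>m\<in>Poly_Mapping.keys p. Poly_Mapping.single m (Poly_Mapping.lookup p m)) k" ..
qed

lemma poly_mapping_single_induct [case_names zero single add]:
  fixes p :: "'a \<Rightarrow>\<^sub>0 'b::comm_monoid_add"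
  assumes "P 0" "\<And>m c. P (Poly_Mapping.single m c)" "\<And>p q. P p \<Longrightarrow> P q \<Longrightarrow> P (p + q)"
  shows "P p"
proof -
  have "P (\<Sum>m\<in>A. Poly_Mapping.single m (Poly_Mapping.lookup p m))" if "finite A" for A
    using that by induction (auto intro: assms)
  from this[OF finite_keys[of p]] show ?thesis
    by (simp flip: poly_mapping_sum_singles)
qed

lemma msubst_mono_superset:
  assumes "finite A" "Poly_Mapping.keys m \<subseteq> A"
  shows "msubst_mono \<sigma> m = (\<Prod>i\<in>A. \<sigma> i ^ Poly_Mapping.lookup m i)"
  unfolding msubst_mono_def using assms
  by (intro prod.mono_neutral_left) (auto simp: in_keys_iff)

lemma msubst_mono_zero [simp]: "msubst_mono \<sigma> 0 = 1"
  by (simp add: msubst_mono_def)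

lemma msubst_mono_add: "msubst_mono \<sigma> (m + m') = msubst_mono \<sigma> m * msubst_mono \<sigma> m'"
proof -
  define A where "A = Poly_Mapping.keys m \<union> Poly_Mapping.keys m'"
  have "finite A" "Poly_Mapping.keys m \<subseteq> A" "Poly_Mapping.keys m' \<subseteq> A" "Poly_Mapping.keys (m + m') \<subseteq> A"
    using keys_add[of m m'] by (auto simp: A_def)
  then show ?thesis
    by (simp add: msubst_mono_superset[of A] lookup_add power_add prod.distrib)
qed

lemma msubst_superset:
  assumes "finite A" "Poly_Mapping.keys p \<subseteq> A"
  shows "msubst \<sigma> p = (\<Sum>m\<in>A. mconst (Poly_Mapping.lookup p m) * msubst_mono \<sigma> m)"
  unfolding msubst_def using assms
  by (intro sum.mono_neutral_left) (auto simp: in_keys_iff)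

lemma msubst_zero [simp]: "msubst \<sigma> 0 = 0"
  by (simp add: msubst_def)

lemma msubst_single [simp]: "msubst \<sigma> (Poly_Mapping.single m c) = mconst c * msubst_mono \<sigma> m"
  by (subst msubst_superset[of "{m}"]) auto

lemma msubst_add: "msubst \<sigma> (p + q) = msubst \<sigma> p + msubst \<sigma> q"
proof -
  define A where "A = Poly_Mapping.keys p \<union> Poly_Mapping.keys q"
  have "finite A" "Poly_Mapping.keys p \<subseteq> A" "Poly_Mapping.keys q \<subseteq> A" "Poly_Mapping.keys (p + q) \<subseteq> A"
    using keys_add[of p q] by (auto simp: A_def)
  then show ?thesis
    by (simp add: msubst_superset[of A] lookup_add mconst_add distrib_right sum.distrib)
qed

lemma msubst_uminus: "msubst \<sigma> (- p) = - msubst \<sigma> p"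
  using msubst_add[of \<sigma> p "- p"] by (simp add: eq_neg_iff_add_eq_0 add.commute)

lemma msubst_diff: "msubst \<sigma> (p - q) = msubst \<sigma> p - msubst \<sigma> q"
  using msubst_add[of \<sigma> p "- q"] by (simp add: msubst_uminus)

lemma msubst_sum: "msubst \<sigma> (\<Sum>i\<in>A. f i) = (\<Sum>i\<in>A. msubst \<sigma> (f i))"
  by (induction A rule: infinite_finite_induct) (simp_all add: msubst_add)

lemma msubst_mult: "msubst \<sigma> (p * q) = msubst \<sigma> p * msubst \<sigma> q"
proof (induction p rule: poly_mapping_single_induct)
  case (single m c)
  show ?case
    by (induction q rule: poly_mapping_single_induct)
      (simp_all add: mult_single msubst_add mconst_mult msubst_mono_add algebra_simps)
qed (simp_all add: msubst_add algebra_simps)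

lemma msubst_mconst [simp]: "msubst \<sigma> (mconst c) = mconst c"
  unfolding mconst_def by (simp add: mconst_def)

lemma msubst_one [simp]: "msubst \<sigma> 1 = 1"
  using msubst_mconst[of \<sigma> 1] by simp

lemma msubst_mvar [simp]: "msubst \<sigma> (mvar i) = \<sigma> i"
  by (simp add: mvar_def msubst_mono_def)

lemma msubst_power: "msubst \<sigma> (p ^ k) = msubst \<sigma> p ^ k"
  by (induction k) (simp_all add: msubst_mult)

lemma msubst_prod: "msubst \<sigma> (\<Prod>i\<in>A. f i) = (\<Prod>i\<in>A. msubst \<sigma> (f i))"
  by (induction A rule: infinite_finite_induct) (simp_all add: msubst_mult)

lemma msubst_msubst: "msubst \<sigma> (msubst \<tau> p) = msubst (\<lambda>i. msubst \<sigma> (\<tau> i)) p"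
  unfolding msubst_def[of \<tau>] msubst_def[of "\<lambda>i. msubst \<sigma> (\<tau> i)"]
  by (simp add: msubst_sum msubst_mult msubst_mono_def msubst_prod msubst_power)

lemma msubst_cong:
  assumes "\<And>m i. m \<in> Poly_Mapping.keys p \<Longrightarrow> i \<in> Poly_Mapping.keys m \<Longrightarrow> \<sigma> i = \<tau> i"
  shows "msubst \<sigma> p = msubst \<tau> p"
  unfolding msubst_def msubst_mono_def
  by (intro sum.cong refl arg_cong2[where f = "(*)"] prod.cong) (auto simp: assms)

lemma msubst_mono_mvar: "msubst_mono mvar m = Poly_Mapping.single m 1"
proof -
  have power: "(mvar i :: 'a mpoly) ^ k = Poly_Mapping.single (Poly_Mapping.single i k) 1" for i k
    by (induction k) (simp_all add: mvar_def mult_single flip: single_add)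
  have "(\<Prod>i\<in>A. (mvar i :: 'a mpoly) ^ Poly_Mapping.lookup m i)
      = Poly_Mapping.single (\<Sum>i\<in>A. Poly_Mapping.single i (Poly_Mapping.lookup m i)) 1" for A
    by (induction A rule: infinite_finite_induct) (simp_all add: mult_single power)
  from this[of "Poly_Mapping.keys m"] show ?thesis
    by (simp add: msubst_mono_def flip: poly_mapping_sum_singles)
qed

lemma msubst_mvar_id [simp]: "msubst mvar p = p"
  by (subst (2) poly_mapping_sum_singles[of p])
    (simp add: msubst_def msubst_mono_mvar mconst_def mult_single)

lemma msubst_mconst_eval: "msubst (\<lambda>i. mconst (t i)) p = mconst (mpoly_eval p t)"
  by (simp add: msubst_def mpoly_eval_def msubst_mono_def mconst_sum mconst_mult
      mconst_prod mconst_power)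

text \<open>The closure assumptions on \<open>I\<close> are those of an ideal, and congruence modulo
  an ideal respects sums and products. It is used for the multiples of \<open>mvar k - p\<close> and
  for the polynomials without constant term.\<close>

lemma msubst_ideal_cong:
  assumes "I 0" and add: "\<And>x y. I x \<Longrightarrow> I y \<Longrightarrow> I (x + y)" and mult: "\<And>x y. I x \<Longrightarrow> I (y * x)"
    and "\<And>i. I (\<sigma> i - \<tau> i)"
  shows "I (msubst \<sigma> p - msubst \<tau> p)"
proof -
  have *: "I (x * y - x' * y')" if "I (x - x')" "I (y - y')" for x y x' y'
  proof -
    have "x * y - x' * y' = y * (x - x') + x' * (y - y')" by (simp add: algebra_simps)
    then show ?thesis using that add mult by simp
  qed
  have power: "I (\<sigma> i ^ k - \<tau> i ^ k)" for i k
    by (induction k) (simp_all add: * assms)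
  have prod: "I ((\<Prod>i\<in>A. \<sigma> i ^ k i) - (\<Prod>i\<in>A. \<tau> i ^ k i))" for A and k :: "nat \<Rightarrow> nat"
    by (induction A rule: infinite_finite_induct) (simp_all add: * assms power)
  have "I (\<Sum>m\<in>A. mconst (Poly_Mapping.lookup p m) * (msubst_mono \<sigma> m - msubst_mono \<tau> m))" for A
    by (induction A rule: infinite_finite_induct)
      (simp_all add: assms prod msubst_mono_def)
  from this[of "Poly_Mapping.keys p"] show ?thesis
    by (simp add: msubst_def sum_subtractf right_diff_distrib)
qed

section \<open>Weights of exponents and their behaviour under substitution\<close>

lemma wdeg_superset:
  assumes "finite A" "Poly_Mapping.keys m \<subseteq> A"
  shows "wdeg u m = (\<Sum>i\<in>A. u i * Poly_Mapping.lookup m i)"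
  unfolding wdeg_def using assms
  by (intro sum.mono_neutral_left) (auto simp: in_keys_iff)

lemma wdeg_zero [simp]: "wdeg u 0 = 0"
  by (simp add: wdeg_def)

lemma wdeg_single [simp]: "wdeg u (Poly_Mapping.single i k) = u i * k"
  by (simp add: wdeg_def)

lemma wdeg_add: "wdeg u (m + m') = wdeg u m + wdeg u m'"
proof -
  define A where "A = Poly_Mapping.keys m \<union> Poly_Mapping.keys m'"
  have "finite A" "Poly_Mapping.keys m \<subseteq> A" "Poly_Mapping.keys m' \<subseteq> A" "Poly_Mapping.keys (m + m') \<subseteq> A"
    using keys_add[of m m'] by (auto simp: A_def)
  then show ?thesis
    by (simp add: wdeg_superset[of A] lookup_add algebra_simps sum.distrib)
qed

lemma keys_mvar [simp]: "Poly_Mapping.keys (mvar i :: 'a::comm_ring_1 mpoly) = {Poly_Mapping.single i 1}"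
  by (simp add: mvar_def)

lemma keys_mconst: "Poly_Mapping.keys (mconst c) \<subseteq> {0}"
  by (simp add: mconst_def)

lemma keys_multE:
  assumes "m \<in> Poly_Mapping.keys (p * q)"
  obtains m1 m2 where "m = m1 + m2" "m1 \<in> Poly_Mapping.keys p" "m2 \<in> Poly_Mapping.keys q"
  using assms keys_mult[of p q] by blast

text \<open>Abstracts what the conditions "weight at least k", "at most k" and "exactly k" share, so
  that a single induction over a substitution serves all three.\<close>

definition graded_family :: "(nat \<Rightarrow> (nat \<Rightarrow>\<^sub>0 nat) set) \<Rightarrow> bool"
  where "graded_family A \<longleftrightarrow>
    0 \<in> A 0 \<and> (\<forall>i j. \<forall>m\<in>A i. \<forall>m'\<in>A j. m + m' \<in> A (i + j))"

lemma graded_family_mult: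
  assumes "graded_family A" "Poly_Mapping.keys p \<subseteq> A i" "Poly_Mapping.keys q \<subseteq> A j"
  shows "Poly_Mapping.keys (p * q) \<subseteq> A (i + j)"
proof
  fix m assume "m \<in> Poly_Mapping.keys (p * q)"
  then obtain a b where "m = a + b" "a \<in> Poly_Mapping.keys p" "b \<in> Poly_Mapping.keys q"
    by (rule keys_multE)
  with assms show "m \<in> A (i + j)"
    unfolding graded_family_def by blast
qed

text \<open>Replacing variable \<open>i\<close> by something of degree \<open>u i\<close> sends the
  monomial \<open>m\<close> to degree \<open>wdeg u m\<close>, since degrees add in products and
  constants have degree 0.\<close>

lemma keys_msubst:
  assumes A: "graded_family A"
    and \<sigma>: "\<And>m i. m \<in> Poly_Mapping.keys p \<Longrightarrow> i \<in> Poly_Mapping.keys m \<Longrightarrow> Poly_Mapping.keys (\<sigma> i) \<subseteq> A (u i)"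
  shows "Poly_Mapping.keys (msubst \<sigma> p) \<subseteq> (\<Union>m\<in>Poly_Mapping.keys p. A (wdeg u m))"
proof -
  have const: "Poly_Mapping.keys (mconst c) \<subseteq> A 0" for c :: 'a
    using A keys_mconst[of c] by (auto simp: graded_family_def)
  define K where "K = (\<lambda>k p. Poly_Mapping.keys (p :: 'a mpoly) \<subseteq> A k)"
  have one: "K 0 1"
    using const[of 1] by (simp add: K_def del: keys_one)
  have mult: "K (i + j) (p * q)" if "K i p" "K j q" for i j p q
    using that graded_family_mult[OF A] by (simp add: K_def)
  have power: "K (u i * k) (\<sigma> i ^ k)" if "K (u i) (\<sigma> i)" for i k
    using that by (induction k) (auto intro: one mult)
  have prod: "K (\<Sum>i\<in>B. u i * k i) (\<Prod>i\<in>B. \<sigma> i ^ k i)"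
    if "\<forall>i\<in>B. K (u i) (\<sigma> i)" for B and k :: "nat \<Rightarrow> nat"
    using that by (induction B rule: infinite_finite_induct) (auto intro: one mult power)
  have "Poly_Mapping.keys (mconst (Poly_Mapping.lookup p m) * msubst_mono \<sigma> m) \<subseteq> A (wdeg u m)"
    if "m \<in> Poly_Mapping.keys p" for m
  proof -
    have "K (wdeg u m) (msubst_mono \<sigma> m)"
      unfolding wdeg_def msubst_mono_def using \<sigma>[OF that] by (intro prod) (auto simp: K_def)
    then have "K (0 + wdeg u m) (mconst (Poly_Mapping.lookup p m) * msubst_mono \<sigma> m)"
      using const by (intro mult) (auto simp: K_def)
    then show ?thesis by (simp add: K_def)
  qed
  then show ?thesis
    unfolding msubst_def
    by (intro order.trans[OF keys_sum] UN_mono) auto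
qed

lemma graded_family_ge: "graded_family (\<lambda>k. {m. k \<le> wdeg u m})"
  and graded_family_le: "graded_family (\<lambda>k. {m. wdeg u m \<le> k})"
  and graded_family_eq: "graded_family (\<lambda>k. {m. wdeg u m = k})"
  by (auto simp: graded_family_def wdeg_add intro: add_mono)

lemma keys_msubst_ge:
  assumes "\<And>i m. m \<in> Poly_Mapping.keys (\<sigma> i) \<Longrightarrow> u i \<le> wdeg v m" "\<And>m. m \<in> Poly_Mapping.keys p \<Longrightarrow> k \<le> wdeg u m"
    and "m \<in> Poly_Mapping.keys (msubst \<sigma> p)"
  shows "k \<le> wdeg v m"
proof -
  have "Poly_Mapping.keys (msubst \<sigma> p) \<subseteq> (\<Union>m'\<in>Poly_Mapping.keys p. {m. wdeg u m' \<le> wdeg v m})"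
    using assms(1) by (intro keys_msubst[OF graded_family_ge]) auto
  with assms(3) obtain m' where "m' \<in> Poly_Mapping.keys p" "wdeg u m' \<le> wdeg v m"
    by blast
  with assms(2)[of m'] show ?thesis by linarith
qed

lemma keys_msubst_le:
  assumes "\<And>i m. m \<in> Poly_Mapping.keys (\<sigma> i) \<Longrightarrow> wdeg v m \<le> u i" "\<And>m. m \<in> Poly_Mapping.keys p \<Longrightarrow> wdeg u m \<le> k"
    and "m \<in> Poly_Mapping.keys (msubst \<sigma> p)"
  shows "wdeg v m \<le> k"
proof -
  have "Poly_Mapping.keys (msubst \<sigma> p) \<subseteq> (\<Union>m'\<in>Poly_Mapping.keys p. {m. wdeg v m \<le> wdeg u m'})"
    using assms(1) by (intro keys_msubst[OF graded_family_le]) auto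
  with assms(3) obtain m' where "m' \<in> Poly_Mapping.keys p" "wdeg v m \<le> wdeg u m'"
    by blast
  with assms(2)[of m'] show ?thesis by linarith
qed

lemma keys_msubst_lt:
  assumes "\<And>i m. m \<in> Poly_Mapping.keys (\<sigma> i) \<Longrightarrow> wdeg v m \<le> u i" "\<And>m. m \<in> Poly_Mapping.keys p \<Longrightarrow> wdeg u m < k"
    and "m \<in> Poly_Mapping.keys (msubst \<sigma> p)"
  shows "wdeg v m < k"
proof -
  have "Poly_Mapping.keys (msubst \<sigma> p) \<subseteq> (\<Union>m'\<in>Poly_Mapping.keys p. {m. wdeg v m \<le> wdeg u m'})"
    using assms(1) by (intro keys_msubst[OF graded_family_le]) auto
  with assms(3) obtain m' where "m' \<in> Poly_Mapping.keys p" "wdeg v m \<le> wdeg u m'"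
    by blast
  with assms(2)[of m'] show ?thesis by linarith
qed

lemma keys_mult_le_lt:
  assumes "\<And>m. m \<in> Poly_Mapping.keys p \<Longrightarrow> wdeg u m \<le> a" "\<And>m. m \<in> Poly_Mapping.keys q \<Longrightarrow> wdeg u m < b"
    and "m \<in> Poly_Mapping.keys (p * q)"
  shows "wdeg u m < a + b"
proof -
  from assms(3) obtain m1 m2
    where "m = m1 + m2" "m1 \<in> Poly_Mapping.keys p" "m2 \<in> Poly_Mapping.keys q"
    by (rule keys_multE)
  with assms(1)[of m1] assms(2)[of m2] show ?thesis
    by (simp add: wdeg_add)
qed

text \<open>The terms of top weight after a substitution depend only on the top-weight terms of what
  is substituted. This later allows each \<open>g\<close> to be replaced by its leading form
  \<open>h\<close>.\<close>

lemma keys_msubst_diff_lt: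
  assumes \<sigma>: "\<And>i m. m \<in> Poly_Mapping.keys (\<sigma> i) \<Longrightarrow> wdeg v m \<le> u i"
    and \<tau>: "\<And>i m. m \<in> Poly_Mapping.keys (\<tau> i) \<Longrightarrow> wdeg v m \<le> u i"
    and diff: "\<And>i m. m \<in> Poly_Mapping.keys (\<sigma> i - \<tau> i) \<Longrightarrow> wdeg v m < u i"
    and p: "\<And>m. m \<in> Poly_Mapping.keys p \<Longrightarrow> wdeg u m \<le> k"
    and m: "m \<in> Poly_Mapping.keys (msubst \<sigma> p - msubst \<tau> p)"
  shows "wdeg v m < k"
proof -
  define le where "le = (\<lambda>k p. \<forall>m\<in>Poly_Mapping.keys (p::'a mpoly). wdeg v m \<le> k)"
  define lt where "lt = (\<lambda>k p. \<forall>m\<in>Poly_Mapping.keys (p::'a mpoly). wdeg v m < k)"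
  have le_mult: "le (a + b) (p * q)" if "le a p" "le b q" for a b p q
    using graded_family_mult[OF graded_family_le, of p v a q b] that by (auto simp: le_def)
  have lt_add: "lt a (p + q)" if "lt a p" "lt a q" for a p q
    using keys_add[of p q] that by (auto simp: lt_def)
  have lt_mult: "lt (a + b) (p * q)" if "le a p" "lt b q" for a b p q
    using keys_mult_le_lt[of p v a q b] that by (auto simp: le_def lt_def)
  \<comment> \<open>\<open>R a p q\<close> says that \<open>p\<close> and \<open>q\<close> have
    weight at most \<open>a\<close> and agree in weight \<open>a\<close>. Unlike the bound on the
    difference alone, this relation is multiplicative.\<close>
  define R where "R = (\<lambda>a p q. le a p \<and> le a q \<and> lt a (p - q))"
  have R_one: "R 0 1 1" by (simp add: R_def le_def lt_def)
  have R_mult: "R (a + b) (p * p') (q * q')" if "R a p q" "R b p' q'" for a b p q p' q'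
  proof -
    have "p * p' - q * q' = p * (p' - q') + q' * (p - q)" by (simp add: algebra_simps)
    moreover have "lt (a + b) (p * (p' - q'))" "lt (b + a) (q' * (p - q))"
      using that by (auto simp: R_def intro: lt_mult)
    ultimately have "lt (a + b) (p * p' - q * q')" by (simp add: lt_add add.commute)
    with that show ?thesis by (auto simp: R_def intro: le_mult)
  qed
  have R: "R (u i) (\<sigma> i) (\<tau> i)" for i
    using \<sigma> \<tau> diff by (auto simp: R_def le_def lt_def)
  have R_power: "R (u i * k) (\<sigma> i ^ k) (\<tau> i ^ k)" for i k
    by (induction k) (auto intro: R_one R_mult R)
  have R_prod: "R (\<Sum>i\<in>A. u i * k i) (\<Prod>i\<in>A. \<sigma> i ^ k i) (\<Prod>i\<in>A. \<tau> i ^ k i)"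
    for A and k :: "nat \<Rightarrow> nat"
    by (induction A rule: infinite_finite_induct) (auto intro: R_one R_mult R_power)
  have "lt k (mconst (Poly_Mapping.lookup p m) * (msubst_mono \<sigma> m - msubst_mono \<tau> m))"
    if "m \<in> Poly_Mapping.keys p" for m
  proof -
    have "lt (0 + wdeg u m) (mconst (Poly_Mapping.lookup p m) * (msubst_mono \<sigma> m - msubst_mono \<tau> m))"
      using R_prod[where A = "Poly_Mapping.keys m" and k = "Poly_Mapping.lookup m"]
        keys_mconst[of "Poly_Mapping.lookup p m"]
      by (intro lt_mult) (auto simp: R_def le_def msubst_mono_def wdeg_def)
    then show ?thesis using p[OF that] by (auto simp: lt_def)
  qed
  then have "lt k (\<Sum>m\<in>A. mconst (Poly_Mapping.lookup p m) * (msubst_mono \<sigma> m - msubst_mono \<tau> m))"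
    if "A \<subseteq> Poly_Mapping.keys p" for A
    using that
  proof (induction A rule: infinite_finite_induct)
    case (insert m A)
    then show ?case by (auto intro: lt_add)
  qed (simp_all add: lt_def)
  from this[of "Poly_Mapping.keys p"] show ?thesis
    using m by (auto simp: lt_def msubst_def sum_subtractf right_diff_distrib)
qed

subsection \<open>Polynomials vanishing to high order on a grid\<close>

definition mem_weight :: "nat set \<Rightarrow> nat \<Rightarrow> nat"
  where "mem_weight Y i = (if i \<in> Y then 1 else 0)"

lemma mem_weight_simps [simp]:
  "i \<in> Y \<Longrightarrow> mem_weight Y i = 1" "i \<notin> Y \<Longrightarrow> mem_weight Y i = 0"
  by (simp_all add: mem_weight_def)

abbreviation deg_in :: "nat set \<Rightarrow> (nat \<Rightarrow>\<^sub>0 nat) \<Rightarrow> nat"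
  where "deg_in Y \<equiv> wdeg (mem_weight Y)"

text \<open>The Taylor expansion of a polynomial at the point \<open>p\<close>, in the variables of
  \<open>Y\<close>: the least \<open>deg_in Y\<close> of its terms is the order of vanishing there.
  The coordinates of \<open>p\<close> are polynomials, so points over F[x] are covered as well as
  points over F.\<close>

definition mshift :: "nat set \<Rightarrow> (nat \<Rightarrow> 'a::comm_ring_1 mpoly) \<Rightarrow> 'a mpoly \<Rightarrow> 'a mpoly"
  where "mshift Y p = msubst (\<lambda>i. if i \<in> Y then mvar i + p i else mvar i)"

definition mpart :: "('b \<Rightarrow> bool) \<Rightarrow> ('b \<Rightarrow>\<^sub>0 'a::comm_monoid_add) \<Rightarrow> 'b \<Rightarrow>\<^sub>0 'a"
  where "mpart P f = (\<Sum>m\<in>{m \<in> Poly_Mapping.keys f. P m}. Poly_Mapping.single m (Poly_Mapping.lookup f m))"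

lemma lookup_mpart: "Poly_Mapping.lookup (mpart P f) m = (if P m then Poly_Mapping.lookup f m else 0)"
proof -
  have "Poly_Mapping.lookup (mpart P f) m =
      (\<Sum>m'\<in>{m \<in> Poly_Mapping.keys f. P m}.
        if m' = m then Poly_Mapping.lookup f m' else 0)"
    by (simp add: mpart_def lookup_sum lookup_single when_def)
  then show ?thesis
    by (simp add: in_keys_iff)
qed

lemma keys_mpart: "Poly_Mapping.keys (mpart P f) = {m \<in> Poly_Mapping.keys f. P m}"
  by (auto simp: in_keys_iff lookup_mpart split: if_splits)

lemma mpart_split: "f = mpart P f + mpart (\<lambda>m. \<not> P m) f"
  by (rule poly_mapping_eqI) (simp add: lookup_add lookup_mpart)

lemma deg_in_mono: "X \<subseteq> Y \<Longrightarrow> deg_in X m \<le> deg_in Y m"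
  unfolding wdeg_def by (intro sum_mono) (auto simp: mem_weight_def)

lemma deg_in_eq_0_iff: "deg_in Y m = 0 \<longleftrightarrow> Poly_Mapping.keys m \<inter> Y = {}"
  by (auto simp: wdeg_def in_keys_iff mem_weight_def)

lemma deg_in_insert:
  assumes "k \<notin> Y"
  shows "deg_in (insert k Y) m = deg_in {k} m + deg_in Y m"
  unfolding wdeg_def sum.distrib[symmetric] using assms
  by (intro sum.cong) (auto simp: mem_weight_def)

lemma msubst_fixed:
  assumes "\<And>m. m \<in> Poly_Mapping.keys p \<Longrightarrow> deg_in Y m = 0" "\<And>i. i \<notin> Y \<Longrightarrow> \<sigma> i = mvar i"
  shows "msubst \<sigma> p = p"
proof -
  have "msubst \<sigma> p = msubst mvar p"
    using assms by (intro msubst_cong) (force simp: deg_in_eq_0_iff)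
  then show ?thesis by simp
qed

section \<open>Eliminating a variable and dividing by a linear factor\<close>

lemma keys_msubst_elim:
  assumes "\<And>m. m \<in> Poly_Mapping.keys p \<Longrightarrow> deg_in {k} m = 0" "m \<in> Poly_Mapping.keys (msubst (mvar(k := p)) f)"
  shows "deg_in {k} m = 0"
proof -
  have "deg_in {k} m \<le> 0"
    using assms by - (rule keys_msubst_le[of "mvar(k := p)" "mem_weight {k}" "\<lambda>_. 0" f],
        auto simp: wdeg_def[of "\<lambda>_. 0"] split: if_splits)
  then show ?thesis by simp
qed

text \<open>The factor theorem: modulo \<open>mvar k - p\<close>, substituting \<open>p\<close> for
  variable \<open>k\<close> changes nothing.\<close>

lemma dvd_of_msubst_eq_0:
  assumes "msubst (mvar(k := p)) f = 0"
  shows "mvar k - p dvd f"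
proof -
  have "mvar k - p dvd msubst mvar f - msubst (mvar(k := p)) f"
    by (rule msubst_ideal_cong) auto
  with assms show ?thesis by simp
qed

lemma lookup_mvar_mult: "Poly_Mapping.lookup (mvar k * g) (Poly_Mapping.single k 1 + m) = Poly_Mapping.lookup g m"
  by (induction g rule: poly_mapping_single_induct)
    (simp_all add: mvar_def mult_single lookup_single when_def distrib_left lookup_add)

text \<open>A term of \<open>g\<close> of top degree in \<open>Y\<close>, multiplied by
  \<open>mvar k\<close>, cannot cancel against \<open>p * g\<close>, whose degree in
  \<open>Y\<close> does not exceed that of \<open>g\<close>. So the linear factor accounts for one
  full degree.\<close>

lemma keys_linear_factor_lt:
  assumes "k \<in> Y" and p: "\<And>m. m \<in> Poly_Mapping.keys p \<Longrightarrow> deg_in Y m = 0"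
    and f: "\<And>m. m \<in> Poly_Mapping.keys ((mvar k - p) * g) \<Longrightarrow> deg_in Y m < Suc N"
    and m: "m \<in> Poly_Mapping.keys g"
  shows "deg_in Y m < N"
proof -
  define b where "b = Max (deg_in Y ` Poly_Mapping.keys g)"
  have "b \<in> deg_in Y ` Poly_Mapping.keys g" unfolding b_def using m by (intro Max_in) auto
  then obtain m0 where m0: "m0 \<in> Poly_Mapping.keys g" "deg_in Y m0 = b" by auto
  have le_b: "deg_in Y m' \<le> b" if "m' \<in> Poly_Mapping.keys g" for m'
    unfolding b_def using that by auto
  let ?m = "Poly_Mapping.single k 1 + m0"
  have deg: "deg_in Y ?m = Suc b"
    using \<open>k \<in> Y\<close> m0 by (simp add: wdeg_add)
  have "?m \<notin> Poly_Mapping.keys (p * g)"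
  proof
    assume "?m \<in> Poly_Mapping.keys (p * g)"
    then obtain m1 m2 where m12: "?m = m1 + m2" "m1 \<in> Poly_Mapping.keys p" "m2 \<in> Poly_Mapping.keys g"
      by (rule keys_multE)
    have "deg_in Y ?m = deg_in Y m1 + deg_in Y m2"
      by (simp only: m12 wdeg_add)
    with deg p[of m1] le_b[of m2] m12 show False by linarith
  qed
  then have "Poly_Mapping.lookup ((mvar k - p) * g) ?m = Poly_Mapping.lookup g m0"
    by (simp only: left_diff_distrib lookup_minus lookup_mvar_mult) (simp add: in_keys_iff)
  then have "?m \<in> Poly_Mapping.keys ((mvar k - p) * g)"
    using m0 by (simp add: in_keys_iff)
  from f[OF this] deg le_b[OF m] show ?thesis by simp
qed

lemma keys_var_factor_ge:
  assumes "k \<in> Y" "\<And>m. m \<in> Poly_Mapping.keys (mvar k * g) \<Longrightarrow> w \<le> deg_in Y m" "m \<in> Poly_Mapping.keys g"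
  shows "w - 1 \<le> deg_in Y m"
proof -
  have "Poly_Mapping.single k 1 + m \<in> Poly_Mapping.keys (mvar k * g)"
    using assms(3) unfolding in_keys_iff lookup_mvar_mult .
  from assms(2)[OF this] \<open>k \<in> Y\<close> show ?thesis
    by (simp add: wdeg_add)
qed

text \<open>The factor \<open>mvar k + c\<close> does not vanish where the variables of
  \<open>Y\<close> are zero, so it contributes nothing to the order there: the part of
  \<open>g\<close> of lowest degree in \<open>Y\<close> is multiplied by \<open>c\<close>, stays
  nonzero in an integral domain, and meets no other term of that degree.\<close>

lemma keys_unit_factor_ge:
  fixes c g :: "'a::idom mpoly"
  assumes "k \<in> Y" and c: "c \<noteq> 0" "\<And>m. m \<in> Poly_Mapping.keys c \<Longrightarrow> deg_in Y m = 0"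
    and f: "\<And>m. m \<in> Poly_Mapping.keys ((mvar k + c) * g) \<Longrightarrow> w \<le> deg_in Y m"
    and m: "m \<in> Poly_Mapping.keys g"
  shows "w \<le> deg_in Y m"
proof -
  define b where "b = Min (deg_in Y ` Poly_Mapping.keys g)"
  have "b \<in> deg_in Y ` Poly_Mapping.keys g" unfolding b_def using m by (intro Min_in) auto
  then obtain m0 where m0: "m0 \<in> Poly_Mapping.keys g" "deg_in Y m0 = b" by auto
  have ge_b: "b \<le> deg_in Y m'" if "m' \<in> Poly_Mapping.keys g" for m'
    unfolding b_def using that by auto
  define g0 where "g0 = mpart (\<lambda>m. deg_in Y m = b) g"
  define g1 where "g1 = mpart (\<lambda>m. deg_in Y m \<noteq> b) g"
  have g: "g = g0 + g1" unfolding g0_def g1_def by (rule mpart_split)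
  have "m0 \<in> Poly_Mapping.keys g0" using m0 by (simp add: g0_def keys_mpart)
  then have "c * g0 \<noteq> 0" using c by auto
  then obtain m1 where m1: "m1 \<in> Poly_Mapping.keys (c * g0)" by (metis keys_eq_empty ex_in_conv)
  have deg: "deg_in Y m1 = b"
    using m1 c(2) by (elim keys_multE) (simp add: g0_def keys_mpart wdeg_add)
  have "m1 \<notin> Poly_Mapping.keys (c * g1)"
  proof
    assume "m1 \<in> Poly_Mapping.keys (c * g1)"
    then obtain m2 m3 where "m1 = m2 + m3" "m2 \<in> Poly_Mapping.keys c" "m3 \<in> Poly_Mapping.keys g1"
      by (rule keys_multE)
    with deg c(2)[of m2] ge_b[of m3] show False by (simp add: wdeg_add g1_def keys_mpart)
  qed
  moreover have "m1 \<notin> Poly_Mapping.keys (mvar k * g)"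
  proof
    assume "m1 \<in> Poly_Mapping.keys (mvar k * g)"
    then obtain m2 m3 where "m1 = m2 + m3" "m2 = Poly_Mapping.single k 1" "m3 \<in> Poly_Mapping.keys g"
      by (rule keys_multE) (simp add: keys_mvar)
    with deg \<open>k \<in> Y\<close> ge_b[of m3] show False by (simp add: wdeg_add)
  qed
  moreover have "(mvar k + c) * g = mvar k * g + c * g0 + c * g1"
    by (metis g add.assoc distrib_left distrib_right)
  ultimately have "m1 \<in> Poly_Mapping.keys ((mvar k + c) * g)"
    using m1 by (simp add: in_keys_iff lookup_add)
  from f[OF this] deg ge_b[OF m] show ?thesis by simp
qed

text \<open>Both sides send variable \<open>k\<close> to \<open>r\<close>, and the coordinates of
  \<open>p\<close> are untouched because they are free of the variables involved. Hence restricting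
  \<open>f\<close> to the value \<open>r\<close> keeps its order at the points of the smaller
  grid.\<close>

lemma mshift_elim:
  assumes "k \<notin> Y" "p k = r"
    and p: "\<And>i m. i \<in> insert k Y \<Longrightarrow> m \<in> Poly_Mapping.keys (p i) \<Longrightarrow> deg_in (insert k Y) m = 0"
  shows "mshift Y p (msubst (mvar(k := r)) f)
    = msubst (mvar(k := 0)) (mshift (insert k Y) p f)"
  unfolding mshift_def msubst_msubst
proof (rule msubst_cong, goal_cases)
  case (1 m i)
  have fix0: "msubst (mvar(k := 0)) (p j) = p j" if "j \<in> insert k Y" for j
    using p[OF that] by (intro msubst_fixed[of _ "insert k Y"]) auto
  have fixs: "msubst (\<lambda>i. if i \<in> Y then mvar i + p i else mvar i) (p k) = p k"
    using p[of k] by (intro msubst_fixed[of _ "insert k Y"]) auto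
  consider "i = k" | "i \<noteq> k" "i \<in> Y" | "i \<noteq> k" "i \<notin> Y" by blast
  then show ?case
  proof cases
    case 1
    with fix0[of k] fixs assms(2) show ?thesis by (simp add: msubst_add)
  next
    case 2
    with fix0[of i] show ?thesis by (simp add: msubst_add)
  qed simp
qed

text \<open>Setting one variable to a grid value gives zero by induction, so the polynomial is divisible
  by a linear factor. Dividing it out lowers the order at that value only, so the inner induction
  allows a different order \<open>\<omega> r\<close> for each value \<open>r\<close> of that variable.\<close>

lemma mpoly_eq_0_if_vanishes_on_grid:
  fixes f :: "'a::idom mpoly"
  assumes "finite Y"
    and A: "\<And>i. i \<in> Y \<Longrightarrow> finite (A i)" "\<And>i. i \<in> Y \<Longrightarrow> card (A i) = q"
    and free: "\<And>i p m. i \<in> Y \<Longrightarrow> p \<in> A i \<Longrightarrow> m \<in> Poly_Mapping.keys p \<Longrightarrow> deg_in Y m = 0"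
    and deg: "\<And>m. m \<in> Poly_Mapping.keys f \<Longrightarrow> deg_in Y m < q * w"
    and order: "\<And>p m. (\<And>i. i \<in> Y \<Longrightarrow> p i \<in> A i) \<Longrightarrow> m \<in> Poly_Mapping.keys (mshift Y p f)
      \<Longrightarrow> w \<le> deg_in Y m"
  shows "f = 0"
  using assms
proof (induction Y arbitrary: f w)
  case empty
  \<comment> \<open>Without variables every term has degree 0; the order then forces
    \<open>w = 0\<close>, and the degree bound would read \<open>0 < q * 0\<close>.\<close>
  have "m \<notin> Poly_Mapping.keys f" for m
  proof
    assume m: "m \<in> Poly_Mapping.keys f"
    have "mshift {} (\<lambda>_. 0) f = f"
      unfolding mshift_def by (intro msubst_fixed[of _ "{}"]) (auto simp: wdeg_def)
    with empty.prems(5)[of "\<lambda>_. 0" m] m have "w \<le> deg_in {} m" by (simp add: wdeg_def)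
    with empty.prems(4)[OF m] show False by (simp add: wdeg_def)
  qed
  then show ?case by (metis keys_eq_empty equals0I)
next
  case (insert k Y)
  let ?Y = "insert k Y"
  note free = insert.prems(3)
  have freek: "deg_in {k} m = 0" if "i \<in> ?Y" "p \<in> A i" "m \<in> Poly_Mapping.keys p" for i p m
    using deg_in_mono[of "{k}" ?Y m] free[OF that] by simp
  have freeY: "deg_in Y m = 0" if "i \<in> ?Y" "p \<in> A i" "m \<in> Poly_Mapping.keys p" for i p m
    using deg_in_mono[OF subset_insertI[of Y k], of m] free[OF that] by linarith
  \<comment> \<open>The outer induction hypothesis, applied to the restriction of \<open>f\<close>
    to the value \<open>r\<close>. It needs the order only at grid points with
    \<open>p k = r\<close>, which permits orders that vary with \<open>r\<close>.\<close>
  have elim_eq_0: "msubst (mvar(k := r)) f = 0"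
    if r: "r \<in> A k" and deg: "\<And>m. m \<in> Poly_Mapping.keys f \<Longrightarrow> deg_in ?Y m < q * w"
      and order: "\<And>p m. (\<And>i. i \<in> ?Y \<Longrightarrow> p i \<in> A i) \<Longrightarrow> p k = r \<Longrightarrow>
        m \<in> Poly_Mapping.keys (mshift ?Y p f) \<Longrightarrow> w \<le> deg_in ?Y m" for r f w
  proof (rule insert.IH)
    fix m assume m: "m \<in> Poly_Mapping.keys (msubst (mvar(k := r)) f)"
    have "deg_in ?Y m < q * w"
    proof (rule keys_msubst_lt[OF _ deg m])
      show "deg_in ?Y m' \<le> mem_weight ?Y i" if "m' \<in> Poly_Mapping.keys ((mvar(k := r)) i)" for i m'
      proof (cases "i = k")
        case True
        have "deg_in ?Y m' = 0"
          by (rule free[of k r]) (use that True r in auto)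
        then show ?thesis by linarith
      qed (use that in simp)
    qed
    then show "deg_in Y m < q * w"
      using deg_in_mono[OF subset_insertI[of Y k], of m] by linarith
  next
    fix p m assume p: "\<And>i. i \<in> Y \<Longrightarrow> p i \<in> A i"
      and m: "m \<in> Poly_Mapping.keys (mshift Y p (msubst (mvar(k := r)) f))"
    let ?p = "p(k := r)"
    have p': "?p i \<in> A i" if "i \<in> ?Y" for i
      using that p r by auto
    have "mshift Y p (msubst (mvar(k := r)) f) = mshift Y ?p (msubst (mvar(k := r)) f)"
      unfolding mshift_def using insert.hyps by (intro msubst_cong) auto
    also have "\<dots> = msubst (mvar(k := 0)) (mshift ?Y ?p f)"
      using insert.hyps p' free by (intro mshift_elim) auto
    finally have m': "m \<in> Poly_Mapping.keys (msubst (mvar(k := 0)) (mshift ?Y ?p f))"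
      using m by simp
    have "w \<le> deg_in ?Y m"
    proof (rule keys_msubst_ge[OF _ _ m'])
      show "mem_weight ?Y i \<le> deg_in ?Y m'" if "m' \<in> Poly_Mapping.keys ((mvar(k := 0)) i)" for i m'
        using that by (cases "i = k") simp_all
    qed (use order[of ?p] p' in auto)
    moreover have "deg_in {k} m = 0"
      using m' by (rule keys_msubst_elim[rotated]) simp
    ultimately show "w \<le> deg_in Y m"
      using deg_in_insert[of k Y m] insert.hyps by simp
  next
    show "finite (A i)" "card (A i) = q" if "i \<in> Y" for i
      using that insert.prems(1,2)[of i] by auto
    show "deg_in Y m = 0" if "i \<in> Y" "p \<in> A i" "m \<in> Poly_Mapping.keys p" for i p m
      using that by (intro freeY[of i p]) auto
  qed
  have eq_0: "f = 0"
    if "(\<Sum>r\<in>A k. \<omega> r) = N" "\<And>m. m \<in> Poly_Mapping.keys f \<Longrightarrow> deg_in ?Y m < N"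
      "\<And>p m. (\<And>i. i \<in> ?Y \<Longrightarrow> p i \<in> A i) \<Longrightarrow> m \<in> Poly_Mapping.keys (mshift ?Y p f) \<Longrightarrow> \<omega> (p k) \<le> deg_in ?Y m"
    for \<omega> :: "'a mpoly \<Rightarrow> nat" and N f
    using that
  proof (induction N arbitrary: \<omega> f)
    case 0
    then show ?case by (metis keys_eq_empty equals0I not_less0)
  next
    case (Suc N)
    have fin: "finite (A k)" and card: "card (A k) = q"
      using insert.prems(1,2)[of k] by auto
    have "A k \<noteq> {}" using Suc.prems(1) by auto
    then have "Max (\<omega> ` A k) \<in> \<omega> ` A k" using fin by (intro Max_in) auto
    then obtain r where r: "r \<in> A k" "\<omega> r = Max (\<omega> ` A k)" by auto
    have le: "\<omega> s \<le> \<omega> r" if "s \<in> A k" for s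
      using that fin r by simp
    \<comment> \<open>The maximal order is at least the average one. Choosing \<open>r\<close> of
      maximal order thus turns the degree bound by the sum of the orders into the bound by
      \<open>q * \<omega> r\<close> that \<open>elim_eq_0\<close> requires.\<close>
    have "Suc N \<le> card (A k) * \<omega> r"
      using sum_bounded_above[of "A k" \<omega> "\<omega> r"] le Suc.prems(1) by simp
    then have bound: "Suc N \<le> q * \<omega> r" by (simp add: card)
    have pos: "\<omega> r > 0" using bound by (cases "\<omega> r") auto
    have "msubst (mvar(k := r)) f = 0"
    proof (rule elim_eq_0[OF r(1)])
      show "deg_in ?Y m < q * \<omega> r" if "m \<in> Poly_Mapping.keys f" for m
        using Suc.prems(2)[OF that] bound by linarith
      show "\<omega> r \<le> deg_in ?Y m" if "\<And>i. i \<in> ?Y \<Longrightarrow> p i \<in> A i" "p k = r"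
        "m \<in> Poly_Mapping.keys (mshift ?Y p f)" for p m
        using Suc.prems(3)[OF that(1,3)] that(2) by simp
    qed
    then have "mvar k - r dvd f" by (rule dvd_of_msubst_eq_0)
    then obtain g where g: "f = (mvar k - r) * g" by (elim dvdE)
    \<comment> \<open>Dividing by the factor costs one degree and at most one order, the latter only
      at \<open>r\<close>. As \<open>\<omega> r\<close> is positive, the sum of the orders drops by
      exactly one.\<close>
    define \<omega>' where "\<omega>' = \<omega>(r := \<omega> r - 1)"
    have "g = 0"
    proof (rule Suc.IH)
      have "(\<Sum>s\<in>A k. \<omega>' s) = (\<omega> r - 1) + (\<Sum>s\<in>A k - {r}. \<omega> s)"
        using fin r(1) by (subst sum.remove[of _ r]) (auto simp: \<omega>'_def intro!: sum.cong)
      also have "\<dots> = N"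
        using Suc.prems(1) pos sum.remove[OF fin r(1), of \<omega>] by simp
      finally show "(\<Sum>s\<in>A k. \<omega>' s) = N" .
    next
      fix m assume "m \<in> Poly_Mapping.keys g"
      then show "deg_in ?Y m < N"
        using Suc.prems(2) free[of k r] r by - (rule keys_linear_factor_lt[of k ?Y r g N], auto simp: g)
    next
      fix p m assume p: "\<And>i. i \<in> ?Y \<Longrightarrow> p i \<in> A i" and m: "m \<in> Poly_Mapping.keys (mshift ?Y p g)"
      have fr: "mshift ?Y p r = r"
        unfolding mshift_def using free[of k r] r by (intro msubst_fixed[of _ ?Y]) auto
      \<comment> \<open>Expanded at \<open>p\<close>, the linear factor is the bare variable if
        \<open>p k = r\<close>; otherwise it has a nonzero term free of \<open>?Y\<close>.\<close>
      have shift: "mshift ?Y p f = (mvar k + (p k - r)) * mshift ?Y p g"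
        using fr by (simp add: g mshift_def msubst_mult msubst_diff algebra_simps)
      show "\<omega>' (p k) \<le> deg_in ?Y m"
      proof (cases "p k = r")
        case True
        have "\<omega> r - 1 \<le> deg_in ?Y m"
          using Suc.prems(3)[OF p] shift True m
          by - (rule keys_var_factor_ge[of k ?Y "mshift ?Y p g"], auto)
        with True show ?thesis by (simp add: \<omega>'_def)
      next
        case False
        have "deg_in ?Y m' = 0" if "m' \<in> Poly_Mapping.keys (p k - r)" for m'
          using that keys_diff[of "p k" r] free[of k "p k"] free[of k r] p[of k] r by auto
        then have "\<omega> (p k) \<le> deg_in ?Y m"
          using Suc.prems(3)[OF p] shift False m
          by - (rule keys_unit_factor_ge[of k ?Y "p k - r" "mshift ?Y p g"], auto)
        with False show ?thesis by (simp add: \<omega>'_def)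
      qed
    qed
    with g show ?case by simp
  qed
  show ?case
    \<comment> \<open>Starting with the same order \<open>w\<close> at each of the \<open>q\<close>
      values, the orders sum to \<open>q * w\<close>.\<close>
    using insert.prems(2)[of k] insert.prems(4,5)
    by (intro eq_0[of "\<lambda>_. w" "q * w"]) auto
qed

subsection \<open>Interpolation with multiplicities\<close>

lemma mpolys_msubst:
  assumes "p \<in> mpolys n" "\<And>i. i < n \<Longrightarrow> \<sigma> i \<in> mpolys n"
  shows "msubst \<sigma> p \<in> mpolys n"
proof -
  have "graded_family (\<lambda>_. {m. Poly_Mapping.keys m \<subseteq> {..<n}})"
    using keys_add by (fastforce simp: graded_family_def)
  then have "Poly_Mapping.keys (msubst \<sigma> p) \<subseteq> (\<Union>m\<in>Poly_Mapping.keys p. {m. Poly_Mapping.keys m \<subseteq> {..<n}})"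
    by (rule keys_msubst) (use assms in \<open>auto simp: mpolys_def\<close>)
  then show ?thesis
    by (auto simp: mpolys_def split: if_splits)
qed

lemma mpolys_closed:
  "mconst c \<in> mpolys n" "i < n \<Longrightarrow> mvar i \<in> mpolys n"
  "p \<in> mpolys n \<Longrightarrow> q \<in> mpolys n \<Longrightarrow> p + q \<in> mpolys n"
  "p \<in> mpolys n \<Longrightarrow> q \<in> mpolys n \<Longrightarrow> p * q \<in> mpolys n"
proof -
  show "mconst c \<in> mpolys n" "i < n \<Longrightarrow> mvar i \<in> mpolys n"
    using keys_mconst[of c] by (auto simp: mpolys_def)
  show "p \<in> mpolys n \<Longrightarrow> q \<in> mpolys n \<Longrightarrow> p + q \<in> mpolys n"
    using keys_add[of p q] by (auto simp: mpolys_def)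
  show "p * q \<in> mpolys n" if "p \<in> mpolys n" "q \<in> mpolys n"
    unfolding mpolys_def
  proof (intro CollectI ballI)
    fix m assume "m \<in> Poly_Mapping.keys (p * q)"
    then obtain a b where "m = a + b" "a \<in> Poly_Mapping.keys p" "b \<in> Poly_Mapping.keys q"
      by (rule keys_multE)
    with that have "Poly_Mapping.keys a \<subseteq> {..<n}" "Poly_Mapping.keys b \<subseteq> {..<n}"
      by (auto simp: mpolys_def)
    with keys_add[of a b] \<open>m = a + b\<close> show "Poly_Mapping.keys m \<subseteq> {..<n}"
      by blast
  qed
qed

section \<open>Counting exponents of bounded total degree\<close>

lemma mono_degree_conv_wdeg: "mono_degree m = wdeg (\<lambda>_. 1) m"
  by (simp add: mono_degree_def wdeg_def)

definition exponents_below :: "nat \<Rightarrow> nat \<Rightarrow> (nat \<Rightarrow>\<^sub>0 nat) set"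
  where "exponents_below n k = {m. Poly_Mapping.keys m \<subseteq> {..<n} \<and> mono_degree m < k}"

text \<open>Stars and bars: a slack entry \<open>k - 1 - mono_degree m\<close> turns the inequality
  on the degree into an equality on the sum of \<open>n + 1\<close> entries.\<close>

lemma bij_betw_exponents_below:
  assumes "k > 0"
  shows "bij_betw (\<lambda>m. map (Poly_Mapping.lookup m) [0..<n] @ [k - 1 - mono_degree m])
    (exponents_below n k) {xs. length xs = n + 1 \<and> sum_list xs = k - 1}"
proof -
  have deg: "mono_degree m = (\<Sum>i<n. Poly_Mapping.lookup m i)" if "Poly_Mapping.keys m \<subseteq> {..<n}" for m
    using that wdeg_superset[of "{..<n}" m "\<lambda>_. 1"] by (simp add: mono_degree_conv_wdeg)
  let ?f = "\<lambda>m. map (Poly_Mapping.lookup m) [0..<n] @ [k - 1 - mono_degree m]"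
  have "inj_on ?f (exponents_below n k)"
  proof (rule inj_onI)
    fix m m' assume m: "m \<in> exponents_below n k" "m' \<in> exponents_below n k" "?f m = ?f m'"
    show "m = m'"
    proof (rule poly_mapping_eqI)
      fix i show "Poly_Mapping.lookup m i = Poly_Mapping.lookup m' i"
      proof (cases "i < n")
        case True
        with m(3) show ?thesis by auto
      next
        case False
        with m(1,2) have "i \<notin> Poly_Mapping.keys m" "i \<notin> Poly_Mapping.keys m'" by (auto simp: exponents_below_def)
        then show ?thesis by (simp add: in_keys_iff)
      qed
    qed
  qed
  moreover have "?f m \<in> {xs. length xs = n + 1 \<and> sum_list xs = k - 1}" if "m \<in> exponents_below n k" for m
    using that deg[of m]
    by (auto simp: exponents_below_def interv_sum_list_conv_sum_set_nat atLeast0LessThan)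
  moreover have "xs \<in> ?f ` exponents_below n k" if xs: "length xs = n + 1" "sum_list xs = k - 1" for xs
  proof -
    define ys where "ys = take n xs"
    have len: "length ys = n" using xs by (simp add: ys_def)
    have split: "xs = ys @ [xs ! n]"
      using xs by (simp add: ys_def take_Suc_conv_app_nth[symmetric])
    define m where "m = Poly_Mapping.nth ys"
    have lookup: "Poly_Mapping.lookup m i = (if i < n then ys ! i else 0)" for i
      by (simp add: m_def lookup_nth nth_default_def len)
    have keys: "Poly_Mapping.keys m \<subseteq> {..<n}"
      by (auto simp: in_keys_iff lookup split: if_splits)
    have "sum_list ys = mono_degree m"
      by (simp add: deg[OF keys] lookup sum_list_sum_nth len atLeast0LessThan)
    moreover have "sum_list ys + xs ! n = k - 1"
      using xs(2) by (subst (asm) split) simp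
    ultimately have "mono_degree m < k" "xs ! n = k - 1 - mono_degree m"
      using assms by auto
    moreover have "map (Poly_Mapping.lookup m) [0..<n] = ys"
      by (rule nth_equalityI) (auto simp: len lookup)
    ultimately show ?thesis
      using keys split by (intro image_eqI[of _ _ m]) (auto simp: exponents_below_def)
  qed
  ultimately show ?thesis
    unfolding bij_betw_def by blast
qed

lemma card_exponents_below: "k > 0 \<Longrightarrow> card (exponents_below n k) = (k - 1 + n) choose n"
  using bij_betw_same_card[OF bij_betw_exponents_below, of k n]
    card_length_sum_list[of "n + 1" "k - 1"] binomial_symmetric[of n "k - 1 + n"]
  by simp

lemma finite_exponents_below: "finite (exponents_below n k)"
proof (cases "k = 0")
  case False
  then have "card (exponents_below n k) > 0"
    by (simp add: card_exponents_below)
  then show ?thesis by (rule card_ge_0_finite)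
qed (simp add: exponents_below_def)

text \<open>The middle quantity is the product k (k + 1) ... (k + n - 1), whose \<open>n\<close>
  factors all lie between \<open>k\<close> and \<open>k + n\<close>.\<close>

lemma binomial_bounds:
  assumes "k > 0"
  shows "real k ^ n \<le> fact n * real ((k - 1 + n) choose n)"
    and "fact n * real ((k - 1 + n) choose n) \<le> (real k + real n) ^ n"
proof -
  have "fact n * real ((k - 1 + n) choose n) = (\<Prod>i<n. real k + real i)"
  proof -
    have "real ((k - 1 + n) choose n) = pochhammer (real k) n / fact n"
      using assms by (simp add: binomial_gbinomial gbinomial_pochhammer' of_nat_diff)
    then show ?thesis by (simp add: pochhammer_prod atLeast0LessThan)
  qed
  moreover have "(\<Prod>i<n. real k) \<le> (\<Prod>i<n. real k + real i)"
    "(\<Prod>i<n. real k + real i) \<le> (\<Prod>i<n. real k + real n)"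
    by (intro prod_mono; simp)+
  ultimately show "real k ^ n \<le> fact n * real ((k - 1 + n) choose n)"
    "fact n * real ((k - 1 + n) choose n) \<le> (real k + real n) ^ n"
    by simp_all
qed

text \<open>Parameter counting by pigeonhole: \<open>\<Phi>\<close> sends a coefficient vector to
  all Taylor coefficients of degree below \<open>r\<close> at the points of \<open>S\<close>. There
  are fewer possible values than vectors, so two vectors collide, and additivity of the shift makes
  the difference of their polynomials vanish to order \<open>r\<close>.\<close>

lemma exists_vanishing_mpoly:
  fixes S :: "(nat \<Rightarrow> 'a::{field, finite}) set"
  assumes "finite S" and card: "card S * card (exponents_below n r) < card (exponents_below n k)"
  obtains P :: "'a mpoly" where "P \<noteq> 0" "P \<in> mpolys n" "\<And>m. m \<in> Poly_Mapping.keys P \<Longrightarrow> mono_degree m < k"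
    "\<And>s m. s \<in> S \<Longrightarrow> m \<in> Poly_Mapping.keys (mshift {..<n} (\<lambda>i. mconst (s i)) P) \<Longrightarrow> r \<le> mono_degree m"
proof -
  let ?E = "exponents_below n k" and ?T = "S \<times> exponents_below n r"
  let ?sh = "\<lambda>s. mshift {..<n} (\<lambda>i. mconst (s i :: 'a))"
  define poly_of :: "((nat \<Rightarrow>\<^sub>0 nat) \<Rightarrow> 'a) \<Rightarrow> 'a mpoly"
    where "poly_of c = (\<Sum>m\<in>?E. Poly_Mapping.single m (c m))" for c
  define \<Phi> where "\<Phi> c = (\<lambda>x\<in>?T. Poly_Mapping.lookup (?sh (fst x) (poly_of c)) (snd x))" for c
  have lookup: "Poly_Mapping.lookup (poly_of c) m = (if m \<in> ?E then c m else 0)" for c m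
    by (simp add: poly_of_def lookup_sum lookup_single when_def finite_exponents_below)
  have "\<not> inj_on \<Phi> (?E \<rightarrow>\<^sub>E UNIV)"
  proof
    assume inj: "inj_on \<Phi> (?E \<rightarrow>\<^sub>E UNIV)"
    have "\<Phi> ` (?E \<rightarrow>\<^sub>E UNIV) \<subseteq> ?T \<rightarrow>\<^sub>E UNIV"
      unfolding \<Phi>_def by (intro image_subsetI restrict_PiE) auto
    moreover have "finite (?T \<rightarrow>\<^sub>E (UNIV :: 'a set))"
      using assms(1) by (intro finite_PiE finite_cartesian_product finite_exponents_below) auto
    ultimately have "card (?E \<rightarrow>\<^sub>E (UNIV :: 'a set)) \<le> card (?T \<rightarrow>\<^sub>E (UNIV :: 'a set))"
      using inj by (intro card_inj_on_le[of \<Phi>])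
    then have "CARD('a) ^ card ?E \<le> CARD('a) ^ card ?T"
      using assms(1) by (simp add: card_PiE finite_exponents_below)
    moreover have "CARD('a) > 1"
      using card_mono[of "UNIV :: 'a set" "{0, 1}"] by simp
    ultimately have "card ?E \<le> card ?T"
      using power_le_imp_le_exp by blast
    with card show False by (simp add: card_cartesian_product)
  qed
  then obtain c c' where c: "c \<in> ?E \<rightarrow>\<^sub>E UNIV" "c' \<in> ?E \<rightarrow>\<^sub>E UNIV" "\<Phi> c = \<Phi> c'" "c \<noteq> c'"
    by (auto simp: inj_on_def)
  define P where "P = poly_of c - poly_of c'"
  from c obtain m where "m \<in> ?E" "c m \<noteq> c' m"
    by (meson PiE_ext)
  then have "Poly_Mapping.lookup P m \<noteq> 0"
    by (simp add: P_def lookup_minus lookup)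
  then have "P \<noteq> 0" by auto
  have keysP: "Poly_Mapping.keys P \<subseteq> ?E"
    by (auto simp: in_keys_iff P_def lookup_minus lookup split: if_splits)
  then have P: "P \<in> mpolys n" "\<And>m. m \<in> Poly_Mapping.keys P \<Longrightarrow> mono_degree m < k"
    by (auto simp: mpolys_def exponents_below_def)
  moreover have "r \<le> mono_degree m" if s: "s \<in> S" and m: "m \<in> Poly_Mapping.keys (?sh s P)" for s m
  proof (rule ccontr)
    assume "\<not> r \<le> mono_degree m"
    have "?sh s P \<in> mpolys n"
      unfolding mshift_def using P(1) by (intro mpolys_msubst) (auto intro!: mpolys_closed)
    with m \<open>\<not> r \<le> mono_degree m\<close> have "(s, m) \<in> ?T"
      using s by (auto simp: mpolys_def exponents_below_def)
    with fun_cong[OF c(3), of "(s, m)"] have "Poly_Mapping.lookup (?sh s (poly_of c)) m = Poly_Mapping.lookup (?sh s (poly_of c')) m"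
      by (simp add: \<Phi>_def)
    then have "Poly_Mapping.lookup (?sh s P) m = 0"
      by (simp add: P_def mshift_def msubst_diff lookup_minus)
    with m show False by (simp add: in_keys_iff)
  qed
  ultimately show ?thesis using that \<open>P \<noteq> 0\<close> by blast
qed

subsection \<open>Polynomials vanishing on a BRK-type set\<close>

text \<open>A substitution that respects the weights sends each homogeneous component to the
  component of the same weight, so components cannot mix.\<close>

lemma mpart_msubst:
  assumes "\<And>i m. m \<in> Poly_Mapping.keys (\<sigma> i) \<Longrightarrow> wdeg v m = u i"
  shows "mpart (\<lambda>m. wdeg v m = b) (msubst \<sigma> p) = msubst \<sigma> (mpart (\<lambda>m. wdeg u m = b) p)"
proof -
  have keys: "Poly_Mapping.keys (msubst \<sigma> q) \<subseteq> (\<Union>m\<in>Poly_Mapping.keys q. {m'. wdeg v m' = wdeg u m})" for q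
    using assms by (intro keys_msubst[OF graded_family_eq]) auto
  let ?p1 = "mpart (\<lambda>m. wdeg u m = b) p" and ?p2 = "mpart (\<lambda>m. \<not> wdeg u m = b) p"
  have deg1: "wdeg v m = b" if "m \<in> Poly_Mapping.keys (msubst \<sigma> ?p1)" for m
    using that keys[of ?p1] by (auto simp: keys_mpart split: if_splits)
  have deg2: "wdeg v m \<noteq> b" if "m \<in> Poly_Mapping.keys (msubst \<sigma> ?p2)" for m
    using that keys[of ?p2] by (auto simp: keys_mpart split: if_splits)
  have "msubst \<sigma> p = msubst \<sigma> ?p1 + msubst \<sigma> ?p2"
    by (subst mpart_split[of p "\<lambda>m. wdeg u m = b"]) (rule msubst_add)
  then show ?thesis
    using deg1 deg2 by (intro poly_mapping_eqI) (force simp: lookup_mpart lookup_add in_keys_iff)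
qed

lemma with_leading_form_keys:
  assumes g: "g \<in> with_leading_form d h" and h: "homogeneous l h"
  shows "m \<in> Poly_Mapping.keys g \<Longrightarrow> mono_degree m \<le> l" and "m \<in> Poly_Mapping.keys (g - h) \<Longrightarrow> mono_degree m < l"
proof -
  have part: "h = mpart (\<lambda>m. mono_degree m = total_degree g) g"
    using g by (simp add: with_leading_form_def homogeneous_part_def mpart_def)
  \<comment> \<open>Here it matters that a homogeneous polynomial is nonzero: a term of
    \<open>h\<close> is a top-degree term of \<open>g\<close>, which pins the total degree of
    \<open>g\<close> to \<open>l\<close>.\<close>
  from h obtain m0 where "m0 \<in> Poly_Mapping.keys h" "mono_degree m0 = l"
    unfolding homogeneous_def by (metis keys_eq_empty equals0I)
  then have l: "total_degree g = l"
    by (subst (asm) part) (auto simp: keys_mpart)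
  have le: "mono_degree m \<le> l" if "m \<in> Poly_Mapping.keys g" for m
    using that unfolding l[symmetric] total_degree_def by (intro Max_ge) auto
  then show "m \<in> Poly_Mapping.keys g \<Longrightarrow> mono_degree m \<le> l" .
  assume m: "m \<in> Poly_Mapping.keys (g - h)"
  have "Poly_Mapping.lookup (g - h) m = (if mono_degree m = l then 0 else Poly_Mapping.lookup g m)"
    by (simp add: lookup_minus part lookup_mpart flip: l)
  with m have "mono_degree m \<noteq> l" "m \<in> Poly_Mapping.keys g"
    by (auto simp: in_keys_iff split: if_splits)
  with le[of m] show "mono_degree m < l" by simp
qed

lemma keys_mconst_mult: "Poly_Mapping.keys (mconst c * p) \<subseteq> Poly_Mapping.keys p"
proof
  fix m assume "m \<in> Poly_Mapping.keys (mconst c * p)"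
  then obtain a b where "m = a + b" "a \<in> Poly_Mapping.keys (mconst c)" "b \<in> Poly_Mapping.keys p"
    by (rule keys_multE)
  with keys_mconst[of c] show "m \<in> Poly_Mapping.keys p" by auto
qed

text \<open>The substitution \<open>\<sigma>\<close> takes the origin to the point \<open>s\<close>.
  It factors as the expansion at \<open>s\<close> followed by \<open>\<eta>\<close>, whose entries
  have no constant term below \<open>n\<close>, so degrees do not drop in the second step.\<close>

lemma vanishing_order_msubst:
  fixes P :: "'a::comm_ring_1 mpoly"
  assumes P: "P \<in> mpolys n"
    and order: "\<And>m. m \<in> Poly_Mapping.keys (mshift {..<n} (\<lambda>i. mconst (s i)) P) \<Longrightarrow> r \<le> mono_degree m"
    and \<sigma>: "\<And>i m. i < n \<Longrightarrow> m \<in> Poly_Mapping.keys (\<sigma> i - mconst (s i)) \<Longrightarrow> 0 < mono_degree m"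
    and m: "m \<in> Poly_Mapping.keys (msubst \<sigma> P)"
  shows "r \<le> mono_degree m"
proof -
  define \<eta> where "\<eta> i = (if i < n then \<sigma> i - mconst (s i) else mvar i)" for i
  have "msubst \<sigma> P = msubst \<eta> (mshift {..<n} (\<lambda>i. mconst (s i)) P)"
    unfolding mshift_def msubst_msubst
  proof (rule msubst_cong)
    fix m i assume "m \<in> Poly_Mapping.keys P" "i \<in> Poly_Mapping.keys m"
    with P have "i < n" by (auto simp: mpolys_def)
    then show "\<sigma> i = msubst \<eta> (if i \<in> {..<n} then mvar i + mconst (s i) else mvar i)"
      by (simp add: msubst_add \<eta>_def)
  qed
  with m have m': "m \<in> Poly_Mapping.keys (msubst \<eta> (mshift {..<n} (\<lambda>i. mconst (s i)) P))" by simp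
  have "r \<le> wdeg (\<lambda>_. 1) m"
  proof (rule keys_msubst_ge[OF _ _ m'])
    show "1 \<le> wdeg (\<lambda>_. 1) m" if "m \<in> Poly_Mapping.keys (\<eta> i)" for i m
    proof (cases "i < n")
      case True
      with \<sigma>[of i m] that show ?thesis by (simp add: \<eta>_def mono_degree_conv_wdeg Suc_le_eq)
    qed (use that in \<open>simp add: \<eta>_def\<close>)
  qed (use order in \<open>simp add: mono_degree_conv_wdeg\<close>)
  then show ?thesis by (simp add: mono_degree_conv_wdeg)
qed

lemma keys_mshift_minus_eval:
  assumes "g \<in> mpolys d" and m: "m \<in> Poly_Mapping.keys (mshift {..<d} (\<lambda>i. mconst (t i)) g - mconst (mpoly_eval g t))"
  shows "0 < mono_degree m"
proof -
  \<comment> \<open>Beyond the first \<open>d\<close> variables \<open>?s\<close> is constant, so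
    that it is congruent to evaluation at every index modulo the polynomials without constant term.
    The polynomial \<open>g\<close> does not involve those variables.\<close>
  let ?s = "\<lambda>i. if i < d then mvar i + mconst (t i) else mconst (t i)"
  have eq: "mshift {..<d} (\<lambda>i. mconst (t i)) g = msubst ?s g"
    unfolding mshift_def using assms(1) by (intro msubst_cong) (auto simp: mpolys_def)
  have "\<forall>m\<in>Poly_Mapping.keys (msubst ?s g - msubst (\<lambda>i. mconst (t i)) g). 0 < mono_degree m"
  proof (rule msubst_ideal_cong, goal_cases)
    case (2 x y)
    then show ?case using keys_add[of x y] by auto
  next
    case (3 x y)
    show ?case
    proof
      fix m assume "m \<in> Poly_Mapping.keys (y * x)"
      then obtain a b where "m = a + b" "b \<in> Poly_Mapping.keys x"
        by (rule keys_multE)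
      with 3 show "0 < mono_degree m" by (auto simp: mono_degree_conv_wdeg wdeg_add)
    qed
  qed (auto simp: mono_degree_conv_wdeg)
  with m show ?thesis by (simp add: eq msubst_mconst_eval)
qed

lemma mono_degree_split: "mono_degree m = deg_in {..<d} m + deg_in {d..} m"
  and wdeg_split: "wdeg (\<lambda>i. if i < d then 1 else l) m = deg_in {..<d} m + l * deg_in {d..} m"
  unfolding mono_degree_conv_wdeg wdeg_def sum_distrib_left sum.distrib[symmetric]
  by (auto intro!: sum.cong simp: mem_weight_def)

lemma wdeg_eq_mono_degree:
  "Poly_Mapping.keys m \<subseteq> {..<d} \<Longrightarrow> wdeg (\<lambda>i. if i < d then 1 else l) m = mono_degree m"
  unfolding mono_degree_conv_wdeg wdeg_def by (intro sum.cong) auto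

text \<open>With q the field size, \<open>deg_order\<close> reads l q w - l b <= q (r - b): for the
  part of degree \<open>b\<close> in the last variables, the degree in the first \<open>d\<close>
  variables stays below q times its remaining order. The grid lemma is applied twice, over F to
  these parts and over F[x] to the top form.\<close>

lemma brk_polynomial_vanishes:
  fixes S :: "(nat \<Rightarrow> 'a::{field, finite}) set" and P :: "'a mpoly"
  assumes "d \<le> n" "l \<ge> 1" "BRK_type_set n d l S"
    and P: "P \<in> mpolys n"
    and order: "\<And>s m. s \<in> S \<Longrightarrow> m \<in> Poly_Mapping.keys (mshift {..<n} (\<lambda>i. mconst (s i)) P) \<Longrightarrow> r \<le> mono_degree m"
    and deg: "\<And>m. m \<in> Poly_Mapping.keys P \<Longrightarrow> mono_degree m < CARD('a) * w"
    and deg_order: "\<And>b. b < w \<Longrightarrow> l * (CARD('a) * w) + CARD('a) * b \<le> CARD('a) * r + l * b"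
  shows "P = 0"
proof (rule ccontr)
  assume "P \<noteq> 0"
  define q where "q = CARD('a)"
  define u where "u = (\<lambda>i. if i < d then 1 else l)"
  have wdeg_u: "wdeg u m = deg_in {..<d} m + l * deg_in {d..} m" for m
    unfolding u_def by (rule wdeg_split)
  obtain h :: "nat \<Rightarrow> 'a mpoly" where
    h0: "\<forall>i < n - d. h i \<in> mpolys d \<and> homogeneous l (h i)"
    and brk: "\<forall>\<rho> \<in> vecs (n - d). \<exists>a \<in> vecs n. \<exists>g :: nat \<Rightarrow> 'a mpoly.
        (\<forall>i < n - d. g i \<in> with_leading_form d (h i)) \<and>
        {brk_point n d a \<rho> g t | t. t \<in> vecs d} \<subseteq> S"
    using assms(3) unfolding BRK_type_set_def by (elim conjE exE) (rule that)
  have h: "h i \<in> mpolys d" "homogeneous l (h i)" if "i < n - d" for i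
    using h0 that by simp_all
  have deg_mpoly_d: "wdeg u m = mono_degree m" "deg_in {d..<n} m = 0" "deg_in {d..} m = 0"
    if "p \<in> mpolys d" "m \<in> Poly_Mapping.keys p" for p :: "'a mpoly" and m
  proof -
    have "Poly_Mapping.keys m \<subseteq> {..<d}" using that by (auto simp: mpolys_def)
    then show "wdeg u m = mono_degree m" "deg_in {d..<n} m = 0" "deg_in {d..} m = 0"
      by (auto simp: u_def wdeg_eq_mono_degree deg_in_eq_0_iff)
  qed

  define D where "D = Max (wdeg u ` Poly_Mapping.keys P)"
  have "D \<in> wdeg u ` Poly_Mapping.keys P"
    unfolding D_def using \<open>P \<noteq> 0\<close> by (intro Max_in) auto
  then obtain m0 where m0: "m0 \<in> Poly_Mapping.keys P" "wdeg u m0 = D" by auto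
  have le_D: "wdeg u m \<le> D" if "m \<in> Poly_Mapping.keys P" for m
    unfolding D_def using that by auto
  have "wdeg u m0 \<le> l * mono_degree m0"
    using \<open>l \<ge> 1\<close> by (simp add: wdeg_u mono_degree_split[of _ d] add_mult_distrib2)
  also have "\<dots> < l * (q * w)"
    using deg[OF m0(1)] \<open>l \<ge> 1\<close> by (simp add: q_def)
  finally have D: "D < l * (q * w)" using m0 by simp
  define top where "top = mpart (\<lambda>m. wdeg u m = D) P"
  define low where "low = mpart (\<lambda>m. \<not> wdeg u m = D) P"
  have P_split: "P = top + low" unfolding top_def low_def by (rule mpart_split)
  have top_n: "top \<in> mpolys n" using P by (auto simp: top_def mpolys_def keys_mpart)
  have "m0 \<in> Poly_Mapping.keys top" using m0 by (simp add: top_def keys_mpart)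
  then have "top \<noteq> 0" by auto

  \<comment> \<open>The top-weight version of the substitution along the set: translations and lower
    terms of \<open>g\<close> are gone, and every variable goes to a polynomial homogeneous of its
    own weight.\<close>
  define \<tau> where "\<tau> \<rho> i = (if i \<in> {d..<n} then mvar i + mconst (\<rho> (i - d)) * h (i - d) else mvar i)"
    for \<rho> i
  have main: "w \<le> deg_in {d..} m" if \<rho>: "\<rho> \<in> vecs (n - d)" and m: "m \<in> Poly_Mapping.keys (msubst (\<tau> \<rho>) top)" for \<rho> m
  proof -
    from bspec[OF brk \<rho>] obtain a and g :: "nat \<Rightarrow> 'a mpoly" where
      g: "\<And>i. i < n - d \<Longrightarrow> g i \<in> with_leading_form d (h i)" and
      subset: "\<And>t. t \<in> vecs d \<Longrightarrow> brk_point n d a \<rho> g t \<in> S" by blast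
    have g_d: "g i \<in> mpolys d" if "i < n - d" for i
      using g[OF that] by (simp add: with_leading_form_def)
    \<comment> \<open>The last \<open>n - d\<close> variables are kept and added to the
      parametrisation, so that the degree in them measures the order of \<open>P\<close>
      transversally to the parametrised set.\<close>
    define \<sigma> where "\<sigma> i = (if i < n then mvar i + mconst (a i) else mvar i)
      + (if i \<in> {d..<n} then mconst (\<rho> (i - d)) * g (i - d) else 0)" for i
    define Q where "Q = msubst \<sigma> P"

    have \<sigma>_le: "wdeg u m \<le> u i" if "m \<in> Poly_Mapping.keys (\<sigma> i)" for i m
    proof -
      have "m \<in> Poly_Mapping.keys (if i < n then mvar i + mconst (a i) else mvar i)
          \<union> Poly_Mapping.keys (if i \<in> {d..<n} then mconst (\<rho> (i - d)) * g (i - d) else 0)"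
        by (rule subsetD[OF keys_add that[unfolded \<sigma>_def]])
      moreover have "Poly_Mapping.keys (if i < n then mvar i + mconst (a i) else mvar i)
          \<subseteq> {Poly_Mapping.single i 1, 0}"
        using keys_add[of "mvar i" "mconst (a i)"] keys_mconst[of "a i"] by auto
      moreover have "Poly_Mapping.keys (if i \<in> {d..<n} then mconst (\<rho> (i - d)) * g (i - d) else 0)
          \<subseteq> (if i \<in> {d..<n} then Poly_Mapping.keys (g (i - d)) else {})"
        by (simp add: keys_mconst_mult)
      ultimately consider "m = Poly_Mapping.single i 1" | "m = 0"
        | "i \<in> {d..<n}" "m \<in> Poly_Mapping.keys (g (i - d))"
        by (cases "i \<in> {d..<n}") auto
      then show ?thesis
      proof cases
        case 3
        then have i: "i - d < n - d" by auto
        have "mono_degree m \<le> l"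
          using with_leading_form_keys(1)[OF g[OF i] h(2)[OF i]] 3 by simp
        with 3 show ?thesis
          using deg_mpoly_d(1)[OF g_d[OF i]] by (simp add: u_def)
      qed auto
    qed
    have \<tau>_eq: "wdeg u m = u i" if "m \<in> Poly_Mapping.keys (\<tau> \<rho> i)" for i m
    proof -
      have "Poly_Mapping.keys (\<tau> \<rho> i) \<subseteq> Poly_Mapping.keys (mvar i :: 'a mpoly)
          \<union> (if i \<in> {d..<n} then Poly_Mapping.keys (h (i - d)) else {})"
        using keys_add[of "mvar i" "mconst (\<rho> (i - d)) * h (i - d)"]
          keys_mconst_mult[of "\<rho> (i - d)" "h (i - d)"] unfolding \<tau>_def by auto
      with that have "m = Poly_Mapping.single i 1 \<or> i \<in> {d..<n} \<and> m \<in> Poly_Mapping.keys (h (i - d))"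
        by (auto split: if_splits)
      then consider "m = Poly_Mapping.single i 1" | "i \<in> {d..<n}" "m \<in> Poly_Mapping.keys (h (i - d))"
        by blast
      then show ?thesis
      proof cases
        case 2
        then have i: "i - d < n - d" by auto
        have "mono_degree m = l"
          using h(2)[OF i] 2 by (simp add: homogeneous_def)
        with 2 show ?thesis
          using deg_mpoly_d(1)[OF h(1)[OF i]] by (simp add: u_def)
      qed auto
    qed
    have diff_lt: "wdeg u m < u i" if "m \<in> Poly_Mapping.keys (\<sigma> i - \<tau> \<rho> i)" for i m
    proof -
      have eq: "\<sigma> i - \<tau> \<rho> i = (if i < n then mconst (a i) else 0)
        + (if i \<in> {d..<n} then mconst (\<rho> (i - d)) * (g (i - d) - h (i - d)) else 0)"
        by (simp add: \<sigma>_def \<tau>_def algebra_simps)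
      have "m \<in> Poly_Mapping.keys (if i < n then mconst (a i) else 0) \<union>
          Poly_Mapping.keys (if i \<in> {d..<n} then mconst (\<rho> (i - d)) * (g (i - d) - h (i - d)) else 0)"
        by (rule subsetD[OF keys_add that[unfolded eq]])
      then consider "m = 0" | "i \<in> {d..<n}" "m \<in> Poly_Mapping.keys (g (i - d) - h (i - d))"
        using keys_mconst[of "a i"] keys_mconst_mult[of "\<rho> (i - d)" "g (i - d) - h (i - d)"]
        by (auto split: if_splits)
      then show ?thesis
      proof cases
        case 1
        then show ?thesis using \<open>l \<ge> 1\<close> by (simp add: u_def)
      next
        case 2
        then have i: "i - d < n - d" by auto
        have "mono_degree m < l"
          using with_leading_form_keys(2)[OF g[OF i] h(2)[OF i]] 2 by simp
        moreover have "m \<in> Poly_Mapping.keys (g (i - d)) \<or> m \<in> Poly_Mapping.keys (h (i - d))"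
          using 2(2) keys_diff[of "g (i - d)" "h (i - d)"] by blast
        then have "wdeg u m = mono_degree m"
          using deg_mpoly_d(1)[OF g_d[OF i]] deg_mpoly_d(1)[OF h(1)[OF i]] by blast
        ultimately show ?thesis using 2 by (simp add: u_def)
      qed
    qed

    have Q_order: "w \<le> deg_in {d..} m" if m: "m \<in> Poly_Mapping.keys Q" for m
    proof (rule ccontr)
      assume "\<not> w \<le> deg_in {d..} m"
      define b where "b = deg_in {d..} m"
      define f where "f = mpart (\<lambda>m. deg_in {d..} m = b) Q"
      have b: "b < w" using \<open>\<not> w \<le> deg_in {d..} m\<close> by (simp add: b_def)
      have bound: "D + q * b < q * r + l * b"
        using deg_order[OF b] D by (simp add: q_def)
      have "m \<in> Poly_Mapping.keys f" using m by (simp add: f_def keys_mpart b_def)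
      moreover have "f = 0"
      \<comment> \<open>First use of the grid lemma: the points are those of F^d, and the part of
        degree \<open>b\<close> in the last variables still has order \<open>r - b\<close> in the
        first \<open>d\<close>.\<close>
      proof (rule mpoly_eq_0_if_vanishes_on_grid[of "{..<d}" "\<lambda>_. range mconst" q f "r - b"])
        show "card (range (mconst :: 'a \<Rightarrow> 'a mpoly)) = q" for i :: nat
          by (simp add: q_def mconst_def[abs_def] card_image[OF inj_single])
        show "deg_in {..<d} m = 0" if "p \<in> range mconst" "m \<in> Poly_Mapping.keys p" for i m and p :: "'a mpoly"
          using that keys_mconst by fastforce
        show "deg_in {..<d} m < q * (r - b)" if m: "m \<in> Poly_Mapping.keys f" for m
        proof -
          have mQ: "m \<in> Poly_Mapping.keys (msubst \<sigma> P)" "deg_in {d..} m = b"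
            using m by (auto simp: f_def keys_mpart Q_def)
          have "wdeg u m \<le> D"
            by (rule keys_msubst_le[OF \<sigma>_le le_D mQ(1)])
          then have "deg_in {..<d} m + l * b \<le> D"
            by (simp add: wdeg_u mQ(2))
          with bound have "deg_in {..<d} m + q * b < q * r" by linarith
          then show ?thesis by (simp add: diff_mult_distrib2)
        qed
        show "r - b \<le> deg_in {..<d} m"
          if p: "\<And>i. i \<in> {..<d} \<Longrightarrow> p i \<in> range mconst" and m: "m \<in> Poly_Mapping.keys (mshift {..<d} p f)" for p m
        proof -
          obtain t0 where t0: "\<And>i. i < d \<Longrightarrow> p i = mconst (t0 i)"
            using p by (simp add: image_iff) metis
          define t where "t = restrict t0 {..<d}"
          have t: "t \<in> vecs d" by (simp add: t_def vecs_def)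
          define s where "s i = (if i \<in> {..<d} then mvar i + p i else mvar i)" for i
          have s: "s = (\<lambda>i. if i \<in> {..<d} then mvar i + mconst (t i) else mvar i)"
            by (auto simp: s_def t0 t_def fun_eq_iff)
          \<comment> \<open>Translating by \<open>t\<close> preserves the degree in the last
            variables, hence commutes with extracting the part of degree \<open>b\<close>.\<close>
          have "mshift {..<d} p f = mpart (\<lambda>m. deg_in {d..} m = b) (msubst s Q)"
            unfolding f_def mshift_def s_def[symmetric]
          proof (rule mpart_msubst[symmetric])
            show "deg_in {d..} m = mem_weight {d..} i" if "m \<in> Poly_Mapping.keys (s i)" for i m
              using that keys_add[of "mvar i" "mconst (t i)"] keys_mconst[of "t i"]
              by (fastforce simp: s split: if_splits)
          qed
          with m have m': "m \<in> Poly_Mapping.keys (msubst (\<lambda>i. msubst s (\<sigma> i)) P)" "deg_in {d..} m = b"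
            by (auto simp: keys_mpart Q_def msubst_msubst)
          have "r \<le> mono_degree m"
          \<comment> \<open>The composite of \<open>\<sigma>\<close> with the translation by
            \<open>t\<close> sends the origin to the point of the set with parameter
            \<open>t\<close>, which lies in \<open>S\<close>.\<close>
          proof (rule vanishing_order_msubst[OF P order[OF subset[OF t]] _ m'(1)])
            fix i m assume i: "i < n"
              and m: "m \<in> Poly_Mapping.keys (msubst s (\<sigma> i) - mconst (brk_point n d a \<rho> g t i))"
            show "0 < mono_degree m"
            proof (cases "i < d")
              case True
              then have "msubst s (\<sigma> i) - mconst (brk_point n d a \<rho> g t i) = mvar i"
                using i by (simp add: \<sigma>_def s brk_point_def msubst_add mconst_add)
              with m show ?thesis by (simp add: mono_degree_conv_wdeg)
            next
              case False
              with i have i': "i - d < n - d" by auto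
              have "msubst s (g (i - d)) = mshift {..<d} (\<lambda>i. mconst (t i)) (g (i - d))"
                by (simp add: s mshift_def)
              then have "msubst s (\<sigma> i) - mconst (brk_point n d a \<rho> g t i) = mvar i +
                mconst (\<rho> (i - d)) * (mshift {..<d} (\<lambda>i. mconst (t i)) (g (i - d))
                  - mconst (mpoly_eval (g (i - d)) t))"
                using i False
                by (simp add: \<sigma>_def brk_point_def msubst_add msubst_mult mconst_add mconst_mult algebra_simps)
                  (simp add: s)
              with m have "m \<in> Poly_Mapping.keys (mvar i + mconst (\<rho> (i - d)) * (mshift {..<d} (\<lambda>i. mconst (t i)) (g (i - d))
                  - mconst (mpoly_eval (g (i - d)) t)))" by simp
              then have "m \<in> Poly_Mapping.keys (mvar i :: 'a mpoly) \<or> m \<in> Poly_Mapping.keys (mshift {..<d} (\<lambda>i. mconst (t i)) (g (i - d))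
                  - mconst (mpoly_eval (g (i - d)) t))"
                by (auto dest!: subsetD[OF keys_add] subsetD[OF keys_mconst_mult])
              then show ?thesis
                using keys_mshift_minus_eval[OF g_d[OF i']] by (auto simp: mono_degree_conv_wdeg)
            qed
          qed
          then show ?thesis using m'(2) by (simp add: mono_degree_split[of _ d])
        qed
      qed auto
      ultimately show False by simp
    qed

    \<comment> \<open>It remains to carry the order from \<open>Q\<close> to \<open>top\<close>. The
      exponent \<open>m\<close> has weight \<open>D\<close>, while replacing \<open>\<sigma>\<close>
      by \<open>\<tau> \<rho>\<close> and dropping \<open>low\<close> affect only smaller weights,
      so \<open>Q\<close> has the same coefficient at \<open>m\<close>.\<close>
    have "Poly_Mapping.keys (msubst (\<tau> \<rho>) top) \<subseteq> (\<Union>m\<in>Poly_Mapping.keys top. {m'. wdeg u m' = wdeg u m})"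
      by (rule keys_msubst[OF graded_family_eq]) (use \<tau>_eq in auto)
    with m have wdeg_m: "wdeg u m = D"
      by (auto simp: top_def keys_mpart split: if_splits)
    have "m \<notin> Poly_Mapping.keys (Q - msubst (\<tau> \<rho>) P)"
    proof
      assume "m \<in> Poly_Mapping.keys (Q - msubst (\<tau> \<rho>) P)"
      then have "wdeg u m < D"
        unfolding Q_def by (rule keys_msubst_diff_lt[rotated -1]) (use \<sigma>_le \<tau>_eq diff_lt le_D in auto)
      with wdeg_m show False by simp
    qed
    moreover have "m \<notin> Poly_Mapping.keys (msubst (\<tau> \<rho>) low)"
    proof
      assume m_low: "m \<in> Poly_Mapping.keys (msubst (\<tau> \<rho>) low)"
      have "wdeg u m < D"
      proof (rule keys_msubst_lt[OF _ _ m_low, of u u])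
        show "wdeg u m' < D" if "m' \<in> Poly_Mapping.keys low" for m'
          using that le_D[of m'] by (auto simp: low_def keys_mpart)
      qed (use \<tau>_eq in auto)
      with wdeg_m show False by simp
    qed
    ultimately have "Poly_Mapping.lookup Q m = Poly_Mapping.lookup (msubst (\<tau> \<rho>) top) m"
      by (simp add: in_keys_iff lookup_minus P_split msubst_add lookup_add)
    with m have "m \<in> Poly_Mapping.keys Q" by (simp add: in_keys_iff)
    then show ?thesis by (rule Q_order)
  qed

  \<comment> \<open>The grid lemma wants a finite set of variables, whereas the weight split uses
    all indices from \<open>d\<close> on.\<close>
  have Zn: "deg_in {d..<n} m = deg_in {d..} m" if "Poly_Mapping.keys m \<subseteq> {..<n}" for m
    unfolding wdeg_def using that by (intro sum.cong) (auto simp: mem_weight_def)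
  have "top = 0"
  \<comment> \<open>Second use of the grid lemma, over F[x]: coordinate \<open>i\<close> takes the
    multiples of \<open>h (i - d)\<close> by constants. These are \<open>q\<close> distinct values
    because \<open>h (i - d)\<close> is nonzero.\<close>
  proof (rule mpoly_eq_0_if_vanishes_on_grid[of "{d..<n}" "\<lambda>i. range (\<lambda>c. mconst c * h (i - d))" q top w])
    show "card (range (\<lambda>c. mconst c * h (i - d))) = q" if "i \<in> {d..<n}" for i
    proof -
      have "h (i - d) \<noteq> 0"
        using h(2)[of "i - d"] diff_less_mono[of i n d] that by (auto simp: homogeneous_def)
      then have "inj (\<lambda>c. mconst c * h (i - d))"
        by (auto simp: inj_on_def mconst_def dest: injD[OF inj_single])
      then show ?thesis by (simp add: q_def card_image)
    qed
    show "deg_in {d..<n} m = 0"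
      if "i \<in> {d..<n}" "p \<in> range (\<lambda>c. mconst c * h (i - d))" "m \<in> Poly_Mapping.keys p" for i p m
    proof -
      have "m \<in> Poly_Mapping.keys (h (i - d))"
        using that keys_mconst_mult[of _ "h (i - d)"] by blast
      with that(1) show ?thesis
        by (intro deg_mpoly_d(2)[OF h(1)[of "i - d"]]) auto
    qed
    show "deg_in {d..<n} m < q * w" if m: "m \<in> Poly_Mapping.keys top" for m
    proof -
      have "Poly_Mapping.keys m \<subseteq> {..<n}" using m top_n by (auto simp: mpolys_def)
      moreover have "wdeg u m = D" using m by (simp add: top_def keys_mpart)
      ultimately have "l * deg_in {d..<n} m \<le> D"
        using wdeg_u[of m] by (simp add: Zn)
      with D have "l * deg_in {d..<n} m < l * (q * w)" by linarith
      then show ?thesis by simp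
    qed
    show "w \<le> deg_in {d..<n} m"
      if p: "\<And>i. i \<in> {d..<n} \<Longrightarrow> p i \<in> range (\<lambda>c. mconst c * h (i - d))"
        and m: "m \<in> Poly_Mapping.keys (mshift {d..<n} p top)" for p m
    proof -
      have "\<forall>i. i \<in> {d..<n} \<longrightarrow> (\<exists>c. p i = mconst c * h (i - d))"
        using p by blast
      then obtain c where c: "\<And>i. i \<in> {d..<n} \<Longrightarrow> p i = mconst (c i) * h (i - d)"
        by metis
      define \<rho> where "\<rho> = (\<lambda>i\<in>{..<n - d}. c (i + d))"
      have \<rho>: "\<rho> \<in> vecs (n - d)" by (simp add: \<rho>_def vecs_def)
      have "mshift {d..<n} p top = msubst (\<tau> \<rho>) top"
        unfolding mshift_def
        by (intro msubst_cong) (auto simp: \<tau>_def c \<rho>_def)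
      with m have m': "m \<in> Poly_Mapping.keys (msubst (\<tau> \<rho>) top)" by simp
      have "\<tau> \<rho> i \<in> mpolys n" if "i < n" for i
      proof -
        have "h (i - d) \<in> mpolys n" if "i \<in> {d..<n}"
          using h(1)[of "i - d"] diff_less_mono[of i n d] that \<open>d \<le> n\<close>
          by (fastforce simp: mpolys_def)
        with \<open>i < n\<close> show ?thesis by (auto simp: \<tau>_def intro!: mpolys_closed)
      qed
      with m' have "Poly_Mapping.keys m \<subseteq> {..<n}"
        using mpolys_msubst[OF top_n, of "\<tau> \<rho>"] by (auto simp: mpolys_def)
      with main[OF \<rho> m'] show ?thesis by (simp add: Zn)
    qed
  qed auto
  with \<open>top \<noteq> 0\<close> show False by simp
qed

subsection \<open>The bound on the cardinality\<close>

lemma finite_vecs: "finite (vecs n :: (nat \<Rightarrow> 'a::finite) set)"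
  unfolding vecs_def by (intro finite_PiE) auto

lemma BRK_type_set_finite_nonempty:
  fixes S :: "(nat \<Rightarrow> 'a::{field, finite}) set"
  assumes "BRK_type_set n d l S"
  shows "finite S" "S \<noteq> {}"
proof -
  show "finite S"
    using assms finite_vecs[of n] unfolding BRK_type_set_def by (blast intro: finite_subset)
  have "(\<lambda>i\<in>{..<k}. 0) \<in> vecs k" for k
    by (simp add: vecs_def)
  then show "S \<noteq> {}"
    using assms unfolding BRK_type_set_def by blast
qed

text \<open>With w = q N the order is chosen so that \<open>deg_order\<close> would be an equality
  at b = w; the factor q in w keeps it an integer. Since \<open>l \<le> q\<close>, the condition l q
  w + (q - l) b <= q r is tightest for the largest b.\<close>

lemma BRK_card_ge_exponents:
  fixes S :: "(nat \<Rightarrow> 'a::{field, finite}) set"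
  assumes "q = CARD('a)" "d \<le> n" "1 \<le> l" "l \<le> q" "BRK_type_set n d l S"
  shows "card (exponents_below n (q * (q * N)))
    \<le> card S * card (exponents_below n (N * (l * q + q - l)))"
proof (rule ccontr)
  let ?r = "N * (l * q + q - l)"
  assume "\<not> ?thesis"
  then have card: "card S * card (exponents_below n ?r) < card (exponents_below n (q * (q * N)))"
    by simp
  obtain P :: "'a mpoly" where P: "P \<noteq> 0" "P \<in> mpolys n"
    "\<And>m. m \<in> Poly_Mapping.keys P \<Longrightarrow> mono_degree m < q * (q * N)"
    "\<And>s m. s \<in> S \<Longrightarrow> m \<in> Poly_Mapping.keys (mshift {..<n} (\<lambda>i. mconst (s i)) P) \<Longrightarrow> ?r \<le> mono_degree m"
    by (rule exists_vanishing_mpoly[OF BRK_type_set_finite_nonempty(1)[OF assms(5)] card]) (rule that)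
  obtain e where e: "q = l + e" using assms(4) le_Suc_ex by blast
  have "P = 0"
  proof (rule brk_polynomial_vanishes[where w = "q * N" and r = ?r, OF assms(2,3,5)])
    fix b assume "b < q * N"
    then have "e * b \<le> e * (q * N)" by simp
    moreover have "q * ?r = l * (q * (q * N)) + e * (q * N)"
      by (simp add: e algebra_simps)
    ultimately show "l * (CARD('a) * (q * N)) + CARD('a) * b \<le> CARD('a) * ?r + l * b"
      unfolding assms(1)[symmetric] by (simp add: e algebra_simps)
  qed (use P assms(1) in auto)
  with P(1) show False ..
qed

lemma BRK_card_bound:
  fixes S :: "(nat \<Rightarrow> 'a::{field, finite}) set"
  assumes "q = CARD('a)" "d \<le> n" "1 \<le> l" "l \<le> q" "BRK_type_set n d l S"
  shows "(real q ^ 2) ^ n \<le> real (card S) * (real l * real q + real q - real l) ^ n"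
proof -
  define c where "c = l * q + q - l"
  have q: "q > 0" by (simp add: assms(1))
  have c: "real c = real l * real q + real q - real l"
    using assms(4) by (simp add: c_def of_nat_diff)
  have "0 < l * q" using q assms(3) by simp
  then have "c > 0" unfolding c_def using assms(4) by linarith
  \<comment> \<open>Both counts are of order N^n. After division by N^n the lower-order terms
    survive only in \<open>n / N\<close>, which tends to 0.\<close>
  have bound: "(real q ^ 2) ^ n \<le> real (card S) * (real c + real n / real N) ^ n" if N: "N > 0" for N
  proof -
    let ?k = "q * (q * N)" and ?r = "N * c"
    have pos: "?k > 0" "?r > 0" using N q \<open>c > 0\<close> by auto
    have "real ?k ^ n \<le> fact n * real (card (exponents_below n ?k))"
      using binomial_bounds(1)[OF pos(1)] by (simp only: card_exponents_below[OF pos(1)])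
    also have "\<dots> \<le> fact n * real (card S * card (exponents_below n ?r))"
      using BRK_card_ge_exponents[OF assms, of N]
      by (intro mult_left_mono) (simp_all add: c_def del: of_nat_mult)
    also have "\<dots> = real (card S) * (fact n * real (card (exponents_below n ?r)))"
      by simp
    also have "\<dots> \<le> real (card S) * (real ?r + real n) ^ n"
      using binomial_bounds(2)[OF pos(2)]
      by (intro mult_left_mono) (simp_all only: card_exponents_below[OF pos(2)] of_nat_0_le_iff)
    also have "real ?r + real n = real N * (real c + real n / real N)"
      using N by (simp add: field_simps)
    also have "real ?k = real N * real q ^ 2"
      by (simp add: power2_eq_square)
    finally have "real N ^ n * (real q ^ 2) ^ n \<le> real N ^ n * (real (card S) * (real c + real n / real N) ^ n)"
      by (simp add: power_mult_distrib mult_ac)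
    then show ?thesis
      using N by simp
  qed
  have "(\<lambda>N. real (card S) * (real c + real n / real N) ^ n) \<longlonglongrightarrow> real (card S) * (real c + 0) ^ n"
    by (intro tendsto_intros lim_const_over_n)
  then have "(real q ^ 2) ^ n \<le> real (card S) * (real c + 0) ^ n"
    by (rule LIMSEQ_le_const) (use bound in \<open>auto intro!: exI[of _ 1]\<close>)
  then show ?thesis by (simp add: c)
qed

theorem theorem1p3:
  fixes S :: "(nat \<Rightarrow> 'a::{field, finite}) set"
    and n d l q :: nat
  assumes "q = CARD('a)"
    and "n \<ge> 2"
    and "1 \<le> d" and "d \<le> n - 1"
    and "l \<ge> 1"
    and "BRK_type_set n d l S"
  shows "real (card S) \<ge> (real q - 1) ^ n / (real l + 1 - 2 * real l / real q) ^ n"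
proof -
  have q: "real q \<ge> 2"
    using card_mono[of "UNIV :: 'a set" "{0, 1}"] by (simp add: assms(1))
  have l: "real l \<ge> 1" using assms(5) by simp
  define D where "D = real l * real q + real q - 2 * real l"
  have den: "real l + 1 - 2 * real l / real q = D / real q"
    using q by (simp add: D_def field_simps)
  have "real l * 2 \<le> real l * real q" using q by (intro mult_left_mono) auto
  then have D: "D > 0" using q by (simp add: D_def)
  define R where "R = (real q - 1) * real q / D"
  have R: "(real q - 1) ^ n / (real l + 1 - 2 * real l / real q) ^ n = R ^ n"
    by (simp add: den R_def flip: power_divide)
  have "R \<ge> 0" using q D by (simp add: R_def)
  show ?thesis
  proof (cases "l \<le> q")
    case True
    define c where "c = real l * real q + real q - real l"
    have "c > 0" using D l by (simp add: c_def D_def)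
    \<comment> \<open>The cross-multiplied form of the comparison between \<open>R\<close> and the
      stronger bound q^2 / c.\<close>
    have "real q ^ 2 * D - (real q - 1) * real q * c = real q * (real q - real l)"
      by (simp add: c_def D_def algebra_simps power2_eq_square)
    also have "\<dots> \<ge> 0" using True by simp
    finally have "R \<le> real q ^ 2 / c"
      using D \<open>c > 0\<close> by (simp add: R_def divide_simps)
    then have "R ^ n \<le> (real q ^ 2 / c) ^ n"
      using \<open>R \<ge> 0\<close> by (rule power_mono)
    also have "\<dots> \<le> real (card S)"
      using BRK_card_bound[OF assms(1) _ assms(5) True assms(6)] assms(4) \<open>c > 0\<close>
      by (simp add: power_divide c_def divide_le_eq)
    finally show ?thesis by (simp add: R)
  next
    case False
    \<comment> \<open>For \<open>l > q\<close> the claimed bound is at most 1, so it suffices that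
      \<open>S\<close> is nonempty.\<close>
    have "D - (real q - 1) * real q = (real l - real q) * (real q - 2)"
      by (simp add: D_def algebra_simps)
    also have "\<dots> \<ge> 0" using False q by simp
    finally have "R \<le> 1" using D by (simp add: R_def)
    then have "R ^ n \<le> 1"
      using \<open>R \<ge> 0\<close> by (intro power_le_one)
    also have "1 \<le> real (card S)"
      using BRK_type_set_finite_nonempty[OF assms(6)] by (simp add: Suc_le_eq card_gt_0_iff)
    finally show ?thesis by (simp add: R)
  qed
qed

end
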